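(* Let $H$ be a Hopf algebra over a field $\Bbbk$. Then there exist a Hopf algebra $L$ over $\Bbbk$ and a partial action $\lambda: L \to \Bbbk$ with $\lambda \neq \varepsilon_L$ (where $\varepsilon_L$ is the counit of $L$) such that $L_\lambda$ is a Hopf subalgebra of $L$ and $L_\lambda \simeq H$ as Hopf algebras.
   Context: All algebras are over a fixed field $\Bbbk$. Sweedler notation $\Delta(h)=h_1\otimes h_2$ is used. A partial action of a Hopf algebra $L$ on its base field $\Bbbk$ is a linear map $\lambda: L\to\Bbbk$ such that $\lambda(1_L)=1_\Bbbk$ and $\lambda(h)\lambda(k)=\lambda(h_1)\lambda(h_2k)$ for all $h,k\in L$. The counit $\varepsilon_L$ is a partial action (the global one). For a partial action $\lambda$, one sets $L_\lambda=\{\lambda(h_1)h_2 \mid h\in L\}$, which is a subalgebra of $L$ (isomorphic to the partial smash product algebra of $\Bbbk$ with $L$), but not necessarily a subcoalgebra. *)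

theory Defs
  imports "HOL-Algebra.Algebra"
begin

text \<open>
  Algebraic structures are records with explicit carriers, as in HOL-Algebra.  Every algebra is over
  a field \<open>K\<close>.  The library locale \<^locale>\<open>algebra\<close> is not used because it requires the algebra
  to be commutative.
\<close>

locale assoc_algebra = K?: field K + module K A + A?: ring A
  for K (structure) and A (structure) +
  assumes smult_mult_left:
      "\<lbrakk>c \<in> carrier K; x \<in> carrier A; y \<in> carrier A\<rbrakk> \<Longrightarrow>
        (c \<odot>\<^bsub>A\<^esub> x) \<otimes>\<^bsub>A\<^esub> y = c \<odot>\<^bsub>A\<^esub> (x \<otimes>\<^bsub>A\<^esub> y)"
    and smult_mult_right:
      "\<lbrakk>c \<in> carrier K; x \<in> carrier A; y \<in> carrier A\<rbrakk> \<Longrightarrow>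
        x \<otimes>\<^bsub>A\<^esub> (c \<odot>\<^bsub>A\<^esub> y) = c \<odot>\<^bsub>A\<^esub> (x \<otimes>\<^bsub>A\<^esub> y)"

definition base_algebra :: "('k, 'x) ring_scheme \<Rightarrow> ('k, 'k) module" where
  "base_algebra K = \<lparr>carrier = carrier K, monoid.mult = monoid.mult K, one = \<one>\<^bsub>K\<^esub>,
     ring.zero = \<zero>\<^bsub>K\<^esub>, ring.add = add K, module.smult = monoid.mult K\<rparr>"

definition linear_maps ::
  "('k, 'x) ring_scheme \<Rightarrow> ('k, 'm, 'y) module_scheme \<Rightarrow> ('k, 'n, 'z) module_scheme \<Rightarrow> ('m \<Rightarrow> 'n) set"
where
  "linear_maps K M N = {f \<in> carrier M \<rightarrow> carrier N.
     (\<forall>x \<in> carrier M. \<forall>y \<in> carrier M. f (x \<oplus>\<^bsub>M\<^esub> y) = f x \<oplus>\<^bsub>N\<^esub> f y) \<and>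
     (\<forall>c \<in> carrier K. \<forall>x \<in> carrier M. f (c \<odot>\<^bsub>M\<^esub> x) = c \<odot>\<^bsub>N\<^esub> f x)}"

definition algebra_homs ::
  "('k, 'x) ring_scheme \<Rightarrow> ('k, 'm, 'y) module_scheme \<Rightarrow> ('k, 'n, 'z) module_scheme \<Rightarrow> ('m \<Rightarrow> 'n) set"
where
  "algebra_homs K A B = linear_maps K A B \<inter> ring_hom A B"


section \<open>Tensor products\<close>

text \<open>
  A list \<open>[(a\<^sub>1, b\<^sub>1), \<dots>, (a\<^sub>n, b\<^sub>n)]\<close> stands for the formal sum of the
  \<open>a\<^sub>i \<otimes> b\<^sub>i\<close>; the tensor product is the quotient of the monoid of lists by the congruence
  generated by commutativity and the bilinearity relations.  Since lists only form a monoid, the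
  relation \<open>0 \<otimes> b = 0\<close> has to be imposed separately; negatives then exist because
  \<open>(- a) \<otimes> b\<close> is inverse to \<open>a \<otimes> b\<close>.
\<close>

inductive_set tensor_rel ::
  "('k, 'x) ring_scheme \<Rightarrow> ('k, 'm, 'y) module_scheme \<Rightarrow> ('k, 'n, 'z) module_scheme \<Rightarrow>
   (('m \<times> 'n) list \<times> ('m \<times> 'n) list) set"
  for K M N
where
  refl: "xs \<in> lists (carrier M \<times> carrier N) \<Longrightarrow> (xs, xs) \<in> tensor_rel K M N"
| sym: "(xs, ys) \<in> tensor_rel K M N \<Longrightarrow> (ys, xs) \<in> tensor_rel K M N"
| trans: "\<lbrakk>(xs, ys) \<in> tensor_rel K M N; (ys, zs) \<in> tensor_rel K M N\<rbrakk> \<Longrightarrow>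
    (xs, zs) \<in> tensor_rel K M N"
| append: "\<lbrakk>(xs, ys) \<in> tensor_rel K M N; (xs', ys') \<in> tensor_rel K M N\<rbrakk> \<Longrightarrow>
    (xs @ xs', ys @ ys') \<in> tensor_rel K M N"
| swap: "\<lbrakk>p \<in> carrier M \<times> carrier N; q \<in> carrier M \<times> carrier N\<rbrakk> \<Longrightarrow>
    ([p, q], [q, p]) \<in> tensor_rel K M N"
| zero: "b \<in> carrier N \<Longrightarrow> ([(\<zero>\<^bsub>M\<^esub>, b)], []) \<in> tensor_rel K M N"
| add_left: "\<lbrakk>a \<in> carrier M; a' \<in> carrier M; b \<in> carrier N\<rbrakk> \<Longrightarrow>
    ([(a \<oplus>\<^bsub>M\<^esub> a', b)], [(a, b), (a', b)]) \<in> tensor_rel K M N"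
| add_right: "\<lbrakk>a \<in> carrier M; b \<in> carrier N; b' \<in> carrier N\<rbrakk> \<Longrightarrow>
    ([(a, b \<oplus>\<^bsub>N\<^esub> b')], [(a, b), (a, b')]) \<in> tensor_rel K M N"
| smult: "\<lbrakk>c \<in> carrier K; a \<in> carrier M; b \<in> carrier N\<rbrakk> \<Longrightarrow>
    ([(c \<odot>\<^bsub>M\<^esub> a, b)], [(a, c \<odot>\<^bsub>N\<^esub> b)]) \<in> tensor_rel K M N"

definition tensor_class ::
  "('k, 'x) ring_scheme \<Rightarrow> ('k, 'm, 'y) module_scheme \<Rightarrow> ('k, 'n, 'z) module_scheme \<Rightarrow>
   ('m \<times> 'n) list \<Rightarrow> ('m \<times> 'n) list set"
where
  "tensor_class K M N xs = tensor_rel K M N `` {xs}"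

text \<open>
  The fields \<open>mult\<close> and \<open>one\<close> of the tensor product are meaningful only when both factors are
  algebras; the multiplication is then \<open>(a \<otimes> b)(c \<otimes> d) = ac \<otimes> bd\<close>.
\<close>

definition tensor ::
  "('k, 'x) ring_scheme \<Rightarrow> ('k, 'm, 'y) module_scheme \<Rightarrow> ('k, 'n, 'z) module_scheme \<Rightarrow>
   ('k, ('m \<times> 'n) list set) module"
where
  "tensor K M N = \<lparr>
     carrier = lists (carrier M \<times> carrier N) // tensor_rel K M N,
     monoid.mult = (\<lambda>s t. \<Union>xs \<in> s. \<Union>ys \<in> t. tensor_class K M N
       [(a \<otimes>\<^bsub>M\<^esub> c, b \<otimes>\<^bsub>N\<^esub> d). (a, b) \<leftarrow> xs, (c, d) \<leftarrow> ys]),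
     one = tensor_class K M N [(\<one>\<^bsub>M\<^esub>, \<one>\<^bsub>N\<^esub>)],
     ring.zero = tensor_class K M N [],
     ring.add = (\<lambda>s t. \<Union>xs \<in> s. \<Union>ys \<in> t. tensor_class K M N (xs @ ys)),
     module.smult = (\<lambda>c t. \<Union>xs \<in> t. tensor_class K M N (map (\<lambda>(a, b). (c \<odot>\<^bsub>M\<^esub> a, b)) xs))\<rparr>"

definition pure_tensor ::
  "('k, 'x) ring_scheme \<Rightarrow> ('k, 'm, 'y) module_scheme \<Rightarrow> ('k, 'n, 'z) module_scheme \<Rightarrow>
   'm \<Rightarrow> 'n \<Rightarrow> ('m \<times> 'n) list set"
where
  "pure_tensor K M N a b = tensor_class K M N [(a, b)]"

text \<open>
  The linear map to \<open>P\<close> induced by a bilinear map \<open>\<beta>\<close> through the universal property.  In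
  Sweedler notation, \<open>tensor_lift P \<beta> (comult H h)\<close> is \<open>\<beta> (h\<^sub>1, h\<^sub>2)\<close>.  The image
  below is a singleton whenever \<open>\<beta>\<close> is bilinear.
\<close>

definition tensor_lift ::
  "('p, 'x) ring_scheme \<Rightarrow> ('m \<Rightarrow> 'n \<Rightarrow> 'p) \<Rightarrow> ('m \<times> 'n) list set \<Rightarrow> 'p"
where
  "tensor_lift P \<beta> t =
     the_elem ((\<lambda>xs. foldr (\<lambda>(a, b) s. \<beta> a b \<oplus>\<^bsub>P\<^esub> s) xs \<zero>\<^bsub>P\<^esub>) ` t)"


section \<open>Hopf algebras\<close>

record ('k, 'h) hopf = "('k, 'h) module" +
  comult :: "'h \<Rightarrow> ('h \<times> 'h) list set"
  counit :: "'h \<Rightarrow> 'k"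
  antipode :: "'h \<Rightarrow> 'h"

text \<open>
  The two triple coproducts \<open>h\<^sub>1\<^sub>1 \<otimes> (h\<^sub>1\<^sub>2 \<otimes> h\<^sub>2)\<close> and
  \<open>h\<^sub>1 \<otimes> (h\<^sub>2\<^sub>1 \<otimes> h\<^sub>2\<^sub>2)\<close> are compared in \<open>H \<otimes> (H \<otimes> H)\<close>.
\<close>

locale hopf_algebra = assoc_algebra K H
  for K :: "('k, 'x) ring_scheme" (structure) and H :: "('k, 'h, 'y) hopf_scheme" (structure) +
  assumes comult_hom: "comult H \<in> algebra_homs K H (tensor K H H)"
    and counit_hom: "counit H \<in> algebra_homs K H (base_algebra K)"
    and coassoc: "h \<in> carrier H \<Longrightarrow>
      tensor_lift (tensor K H (tensor K H H))
        (\<lambda>a b. tensor_lift (tensor K H (tensor K H H))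
          (\<lambda>c d. pure_tensor K H (tensor K H H) c (pure_tensor K H H d b)) (comult H a))
        (comult H h) =
      tensor_lift (tensor K H (tensor K H H))
        (\<lambda>a b. pure_tensor K H (tensor K H H) a (comult H b)) (comult H h)"
    and counit_left: "h \<in> carrier H \<Longrightarrow>
      tensor_lift H (\<lambda>a b. counit H a \<odot>\<^bsub>H\<^esub> b) (comult H h) = h"
    and counit_right: "h \<in> carrier H \<Longrightarrow>
      tensor_lift H (\<lambda>a b. counit H b \<odot>\<^bsub>H\<^esub> a) (comult H h) = h"
    and antipode_linear: "antipode H \<in> linear_maps K H H"
    and antipode_left: "h \<in> carrier H \<Longrightarrow>
      tensor_lift H (\<lambda>a b. antipode H a \<otimes>\<^bsub>H\<^esub> b) (comult H h) = counit H h \<odot>\<^bsub>H\<^esub> \<one>\<^bsub>H\<^esub>"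
    and antipode_right: "h \<in> carrier H \<Longrightarrow>
      tensor_lift H (\<lambda>a b. a \<otimes>\<^bsub>H\<^esub> antipode H b) (comult H h) = counit H h \<odot>\<^bsub>H\<^esub> \<one>\<^bsub>H\<^esub>"

definition tensor_map ::
  "('k, 'x) ring_scheme \<Rightarrow> ('k, 'm, 'y) module_scheme \<Rightarrow> ('k, 'n, 'z) module_scheme \<Rightarrow>
   ('a \<Rightarrow> 'm) \<Rightarrow> ('b \<Rightarrow> 'n) \<Rightarrow> ('a \<times> 'b) list set \<Rightarrow> ('m \<times> 'n) list set"
where
  "tensor_map K M N f g = tensor_lift (tensor K M N) (\<lambda>a b. pure_tensor K M N (f a) (g b))"

definition hopf_homs ::
  "('k, 'x) ring_scheme \<Rightarrow> ('k, 'a, 'y) hopf_scheme \<Rightarrow> ('k, 'b, 'z) hopf_scheme \<Rightarrow> ('a \<Rightarrow> 'b) set"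
where
  "hopf_homs K A B = {f \<in> algebra_homs K A B. \<forall>a \<in> carrier A.
     comult B (f a) = tensor_map K B B f f (comult A a) \<and>
     counit B (f a) = counit A a \<and>
     antipode B (f a) = f (antipode A a)}"

definition hopf_isomorphic ::
  "('k, 'x) ring_scheme \<Rightarrow> ('k, 'a, 'y) hopf_scheme \<Rightarrow> ('k, 'b, 'z) hopf_scheme \<Rightarrow> bool"
where
  "hopf_isomorphic K A B \<longleftrightarrow> (\<exists>f \<in> hopf_homs K A B. bij_betw f (carrier A) (carrier B))"

text \<open>
  The canonical map from \<open>A \<otimes> A\<close> to \<open>L \<otimes> L\<close> for a subspace \<open>A\<close> of \<open>L\<close>; it is
  injective because the scalars form a field.
\<close>

definition tensor_incl ::
  "('k, 'x) ring_scheme \<Rightarrow> ('k, 'h, 'y) module_scheme \<Rightarrow> ('h \<times> 'h) list set \<Rightarrow> ('h \<times> 'h) list set"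
where
  "tensor_incl K L = tensor_map K L L (\<lambda>a. a) (\<lambda>a. a)"

definition hopf_subalgebra ::
  "('k, 'x) ring_scheme \<Rightarrow> 'h set \<Rightarrow> ('k, 'h, 'y) hopf_scheme \<Rightarrow> bool"
where
  "hopf_subalgebra K A L \<longleftrightarrow> submodule A K L \<and> subring A L \<and>
     (\<forall>a \<in> A. comult L a \<in> tensor_incl K L ` carrier (tensor K (L\<lparr>carrier := A\<rparr>) (L\<lparr>carrier := A\<rparr>))) \<and>
     (\<forall>a \<in> A. antipode L a \<in> A)"

text \<open>The Hopf algebra structure on a Hopf subalgebra \<open>A\<close> inherited from \<open>L\<close>.\<close>

definition sub_hopf ::
  "('k, 'x) ring_scheme \<Rightarrow> ('k, 'h) hopf \<Rightarrow> 'h set \<Rightarrow> ('k, 'h) hopf"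
where
  "sub_hopf K L A = L\<lparr>carrier := A,
     comult := (\<lambda>a. inv_into (carrier (tensor K (L\<lparr>carrier := A\<rparr>) (L\<lparr>carrier := A\<rparr>)))
       (tensor_incl K L) (comult L a))\<rparr>"


section \<open>Partial actions on the base field\<close>

definition partial_action ::
  "('k, 'x) ring_scheme \<Rightarrow> ('k, 'h, 'y) hopf_scheme \<Rightarrow> ('h \<Rightarrow> 'k) \<Rightarrow> bool"
where
  "partial_action K L l \<longleftrightarrow> l \<in> linear_maps K L (base_algebra K) \<and> l \<one>\<^bsub>L\<^esub> = \<one>\<^bsub>K\<^esub> \<and>
     (\<forall>h \<in> carrier L. \<forall>k \<in> carrier L.
        l h \<otimes>\<^bsub>K\<^esub> l k =
        tensor_lift K (\<lambda>a b. l a \<otimes>\<^bsub>K\<^esub> l (b \<otimes>\<^bsub>L\<^esub> k)) (comult L h))"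

text \<open>The set of all \<open>\<lambda>(h\<^sub>1) h\<^sub>2\<close>.\<close>

definition partial_smash :: "('k, 'h, 'y) hopf_scheme \<Rightarrow> ('h \<Rightarrow> 'k) \<Rightarrow> 'h set" where
  "partial_smash L l =
     (\<lambda>h. tensor_lift L (\<lambda>a b. l a \<odot>\<^bsub>L\<^esub> b) (comult L h)) ` carrier L"

end

theory Submission
  imports Defs
begin

text \<open>
  Take \<open>L = H \<otimes> k[C\<^sub>2]\<close> with \<open>C\<^sub>2 = {1, g}\<close>, and let \<open>\<lambda>(a \<otimes> 1) = \<epsilon>(a)\<close> and \<open>\<lambda>(b \<otimes> g) = 0\<close>. This differs
  from the counit of \<open>L\<close>, which takes the value \<open>1\<close> at \<open>1 \<otimes> g\<close>. Both \<open>1\<close> and \<open>g\<close> are grouplike, so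
  \<open>\<Delta>\<close> maps \<open>H \<otimes> 1\<close> and \<open>H \<otimes> g\<close> to their own tensor squares. Hence \<open>\<lambda>(h\<^sub>1) h\<^sub>2\<close> is \<open>h\<close> for \<open>h\<close> in
  \<open>H \<otimes> 1\<close>, by the counit law of \<open>H\<close>, and \<open>0\<close> for \<open>h\<close> in \<open>H \<otimes> g\<close>. The same
  computation shows that \<open>\<lambda>\<close> is a partial action, and \<open>L\<^sub>\<lambda> = H \<otimes> 1\<close> is a Hopf subalgebra isomorphic to
  \<open>H\<close> through \<open>a \<otimes> 1 \<mapsto> a\<close>.

  Most of the work is to make Sweedler notation available for tensor products defined as quotients of
  lists: the tensor product is a module with the usual universal property, and for algebras it has a
  well-defined bilinear product. On top of this, \<open>comult_map\<close> collects what a linear map commuting with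
  coproducts transports. The embeddings \<open>a \<mapsto> a \<otimes> 1\<close> and \<open>b \<mapsto> b \<otimes> g\<close> are such maps and their
  images span \<open>L\<close>. So the coassociativity, counit and antipode laws of \<open>L\<close> (\<open>C2_hopf_algebra\<close>), the
  partial action law (\<open>action_partial\<close>) and the description of \<open>L\<^sub>\<lambda>\<close> (\<open>partial_smash_eq\<close>) all reduce
  to laws of \<open>H\<close>.
\<close>


section \<open>The tensor product of modules\<close>

locale module_pair = M: module K M + N: module K N for K (structure) and M and N
begin

lemma tensor_rel_carrier:
  assumes "(xs, ys) \<in> tensor_rel K M N"
  shows "xs \<in> lists (carrier M \<times> carrier N) \<and> ys \<in> lists (carrier M \<times> carrier N)"
  using assms by (induction rule: tensor_rel.induct) auto

lemma tensor_rel_equiv: "equiv (lists (carrier M \<times> carrier N)) (tensor_rel K M N)"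
  using tensor_rel_carrier
  by (auto intro!: equivI refl_onI symI transI intro: tensor_rel.intros)

lemma tensor_class_eq:
  assumes "(xs, ys) \<in> tensor_rel K M N"
  shows "tensor_class K M N xs = tensor_class K M N ys"
  unfolding tensor_class_def using equiv_class_eq[OF tensor_rel_equiv assms] .

lemma tensor_class_closed:
  "xs \<in> lists (carrier M \<times> carrier N) \<Longrightarrow> tensor_class K M N xs \<in> carrier (tensor K M N)"
  by (simp add: tensor_def tensor_class_def quotientI)

lemma tensor_classE:
  assumes "t \<in> carrier (tensor K M N)"
  obtains xs where "xs \<in> lists (carrier M \<times> carrier N)" "t = tensor_class K M N xs"
  using assms by (auto simp: tensor_def tensor_class_def quotient_def)

text \<open>
  The operations of the tensor product are defined as unions over all representatives. Such a union
  collapses to a single class because the summands agree on equivalent representatives.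
\<close>

lemma UN_tensor_class:
  assumes xs: "xs \<in> lists (carrier M \<times> carrier N)"
    and f: "\<And>ys. (xs, ys) \<in> tensor_rel K M N \<Longrightarrow> f ys = u"
  shows "(\<Union>ys \<in> tensor_class K M N xs. f ys) = u"
  using f tensor_rel.refl[OF xs, of K] by (auto simp: tensor_class_def)

lemma add_tensor_class:
  assumes "xs \<in> lists (carrier M \<times> carrier N)" "ys \<in> lists (carrier M \<times> carrier N)"
  shows "tensor_class K M N xs \<oplus>\<^bsub>tensor K M N\<^esub> tensor_class K M N ys = tensor_class K M N (xs @ ys)"
proof -
  have "tensor_class K M N (as @ bs) = tensor_class K M N (xs @ ys)"
    if "(xs, as) \<in> tensor_rel K M N" "(ys, bs) \<in> tensor_rel K M N" for as bs
    by (intro tensor_class_eq tensor_rel.sym[OF tensor_rel.append] that)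
  then show ?thesis
    using assms by (simp add: tensor_def UN_tensor_class del: in_lists_conv_set)
qed

lemma map_smult_lists:
  "c \<in> carrier K \<Longrightarrow> xs \<in> lists (carrier M \<times> carrier N) \<Longrightarrow>
    map (\<lambda>(a, b). (c \<odot>\<^bsub>M\<^esub> a, b)) xs \<in> lists (carrier M \<times> carrier N)"
  by (induction xs) auto

lemma smult_tensor_rel:
  assumes "(xs, ys) \<in> tensor_rel K M N" "c \<in> carrier K"
  shows "(map (\<lambda>(a, b). (c \<odot>\<^bsub>M\<^esub> a, b)) xs, map (\<lambda>(a, b). (c \<odot>\<^bsub>M\<^esub> a, b)) ys) \<in> tensor_rel K M N"
  using assms
proof (induction rule: tensor_rel.induct)
  case (refl xs)
  then show ?case by (intro tensor_rel.refl map_smult_lists)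
next
  case (smult d a b)
  then have "c \<odot>\<^bsub>M\<^esub> (d \<odot>\<^bsub>M\<^esub> a) = d \<odot>\<^bsub>M\<^esub> (c \<odot>\<^bsub>M\<^esub> a)"
    by (simp flip: M.smult_assoc1 add: M.R.m_comm)
  with smult show ?case by (auto intro: tensor_rel.smult)
qed (auto intro: tensor_rel.intros simp: M.smult_r_distr)

lemma smult_tensor_class:
  assumes "c \<in> carrier K" "xs \<in> lists (carrier M \<times> carrier N)"
  shows "c \<odot>\<^bsub>tensor K M N\<^esub> tensor_class K M N xs =
    tensor_class K M N (map (\<lambda>(a, b). (c \<odot>\<^bsub>M\<^esub> a, b)) xs)"
proof -
  have "tensor_class K M N (map (\<lambda>(a, b). (c \<odot>\<^bsub>M\<^esub> a, b)) ys) =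
      tensor_class K M N (map (\<lambda>(a, b). (c \<odot>\<^bsub>M\<^esub> a, b)) xs)"
    if "(xs, ys) \<in> tensor_rel K M N" for ys
    by (intro tensor_class_eq tensor_rel.sym[OF smult_tensor_rel] that assms)
  then show ?thesis
    using assms by (simp add: tensor_def UN_tensor_class del: in_lists_conv_set)
qed

lemma pure_tensor_closed [simp]:
  "a \<in> carrier M \<Longrightarrow> b \<in> carrier N \<Longrightarrow> pure_tensor K M N a b \<in> carrier (tensor K M N)"
  by (simp add: pure_tensor_def tensor_class_closed)

lemma tensor_class_Nil: "tensor_class K M N [] = \<zero>\<^bsub>tensor K M N\<^esub>"
  by (simp add: tensor_def)

lemma tensor_class_Cons:
  assumes "a \<in> carrier M" "b \<in> carrier N" "xs \<in> lists (carrier M \<times> carrier N)"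
  shows "tensor_class K M N ((a, b) # xs) =
    pure_tensor K M N a b \<oplus>\<^bsub>tensor K M N\<^esub> tensor_class K M N xs"
  using assms by (simp add: pure_tensor_def add_tensor_class)

text \<open>
  A class of lists is a finite sum of pure tensors, so properties of tensors can be proved by adding
  one pure tensor at a time. Nearly all later arguments avoid representatives in this way.
\<close>

lemma tensor_induct [consumes 1, case_names zero add]:
  assumes t: "t \<in> carrier (tensor K M N)"
    and zero: "P \<zero>\<^bsub>tensor K M N\<^esub>"
    and add: "\<And>a b t. a \<in> carrier M \<Longrightarrow> b \<in> carrier N \<Longrightarrow> t \<in> carrier (tensor K M N) \<Longrightarrow> P t \<Longrightarrow>
      P (pure_tensor K M N a b \<oplus>\<^bsub>tensor K M N\<^esub> t)"
  shows "P t"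
proof -
  obtain xs where xs: "xs \<in> lists (carrier M \<times> carrier N)" and t: "t = tensor_class K M N xs"
    using t by (rule tensor_classE)
  from xs have "P (tensor_class K M N xs)"
  proof (induction xs)
    case Nil
    then show ?case using zero by (simp add: tensor_class_Nil)
  next
    case (Cons p xs)
    then show ?case
      using add by (cases p) (auto simp: tensor_class_Cons tensor_class_closed)
  qed
  then show ?thesis by (simp add: t)
qed

text \<open>
  Only the exchange of two single terms is a generating relation. Moving one term past a whole list,
  and then the terms of a list one by one, gives commutativity of the addition.
\<close>

lemma tensor_rel_append_commute:
  assumes "xs \<in> lists (carrier M \<times> carrier N)" "ys \<in> lists (carrier M \<times> carrier N)"
  shows "(xs @ ys, ys @ xs) \<in> tensor_rel K M N"
proof -
  have single: "([p] @ ys, ys @ [p]) \<in> tensor_rel K M N"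
    if "p \<in> carrier M \<times> carrier N" "ys \<in> lists (carrier M \<times> carrier N)" for p ys
    using that(2)
  proof (induction ys)
    case Nil
    with that(1) show ?case by (auto intro: tensor_rel.refl)
  next
    case (Cons q ys)
    have "([p, q] @ ys, [q, p] @ ys) \<in> tensor_rel K M N"
      using Cons that(1) by (intro tensor_rel.append tensor_rel.swap tensor_rel.refl) auto
    moreover have "([q] @ ([p] @ ys), [q] @ (ys @ [p])) \<in> tensor_rel K M N"
      using Cons by (intro tensor_rel.append[OF tensor_rel.refl]) auto
    ultimately show ?case by (auto intro: tensor_rel.trans)
  qed
  show ?thesis using assms(1)
  proof (induction xs)
    case Nil
    with assms(2) show ?case by (auto intro: tensor_rel.refl)
  next
    case (Cons p xs)
    have "([p] @ (xs @ ys), [p] @ (ys @ xs)) \<in> tensor_rel K M N"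
      using Cons by (intro tensor_rel.append[OF tensor_rel.refl]) auto
    moreover have "(([p] @ ys) @ xs, (ys @ [p]) @ xs) \<in> tensor_rel K M N"
      using Cons assms(2) by (intro tensor_rel.append single tensor_rel.refl) auto
    ultimately show ?case by (auto intro: tensor_rel.trans)
  qed
qed

lemma pure_tensor_add_left:
  "\<lbrakk>a \<in> carrier M; a' \<in> carrier M; b \<in> carrier N\<rbrakk> \<Longrightarrow>
    pure_tensor K M N (a \<oplus>\<^bsub>M\<^esub> a') b = pure_tensor K M N a b \<oplus>\<^bsub>tensor K M N\<^esub> pure_tensor K M N a' b"
  by (simp add: pure_tensor_def add_tensor_class tensor_class_eq[OF tensor_rel.add_left])

lemma pure_tensor_add_right:
  "\<lbrakk>a \<in> carrier M; b \<in> carrier N; b' \<in> carrier N\<rbrakk> \<Longrightarrow>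
    pure_tensor K M N a (b \<oplus>\<^bsub>N\<^esub> b') = pure_tensor K M N a b \<oplus>\<^bsub>tensor K M N\<^esub> pure_tensor K M N a b'"
  by (simp add: pure_tensor_def add_tensor_class tensor_class_eq[OF tensor_rel.add_right])

lemma smult_pure_tensor:
  "\<lbrakk>c \<in> carrier K; a \<in> carrier M; b \<in> carrier N\<rbrakk> \<Longrightarrow>
    c \<odot>\<^bsub>tensor K M N\<^esub> pure_tensor K M N a b = pure_tensor K M N (c \<odot>\<^bsub>M\<^esub> a) b"
  by (simp add: pure_tensor_def smult_tensor_class)

lemma pure_tensor_smult_right:
  "\<lbrakk>c \<in> carrier K; a \<in> carrier M; b \<in> carrier N\<rbrakk> \<Longrightarrow>
    pure_tensor K M N a (c \<odot>\<^bsub>N\<^esub> b) = c \<odot>\<^bsub>tensor K M N\<^esub> pure_tensor K M N a b"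
  by (simp add: smult_pure_tensor)
    (simp add: pure_tensor_def tensor_class_eq[OF tensor_rel.smult])

lemma pure_tensor_zero_left:
  "b \<in> carrier N \<Longrightarrow> pure_tensor K M N \<zero>\<^bsub>M\<^esub> b = \<zero>\<^bsub>tensor K M N\<^esub>"
  using tensor_class_eq[OF tensor_rel.zero, of b]
  by (simp add: pure_tensor_def tensor_class_Nil)

lemma tensor_abelian_group: "abelian_group (tensor K M N)"
proof (rule abelian_groupI)
  show "\<zero>\<^bsub>tensor K M N\<^esub> \<in> carrier (tensor K M N)"
    using tensor_class_closed[of "[]"] by (simp add: tensor_class_Nil)
  show closed: "s \<oplus>\<^bsub>tensor K M N\<^esub> t \<in> carrier (tensor K M N)"
    if "s \<in> carrier (tensor K M N)" "t \<in> carrier (tensor K M N)" for s t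
    using that by (elim tensor_classE) (simp add: add_tensor_class tensor_class_closed)
  show l_zero: "\<zero>\<^bsub>tensor K M N\<^esub> \<oplus>\<^bsub>tensor K M N\<^esub> s = s" if "s \<in> carrier (tensor K M N)" for s
    using that by (elim tensor_classE) (simp add: add_tensor_class flip: tensor_class_Nil)
  show assoc: "(s \<oplus>\<^bsub>tensor K M N\<^esub> t) \<oplus>\<^bsub>tensor K M N\<^esub> u = s \<oplus>\<^bsub>tensor K M N\<^esub> (t \<oplus>\<^bsub>tensor K M N\<^esub> u)"
    if "s \<in> carrier (tensor K M N)" "t \<in> carrier (tensor K M N)" "u \<in> carrier (tensor K M N)"
    for s t u
    using that by (elim tensor_classE) (simp add: add_tensor_class)
  show comm: "s \<oplus>\<^bsub>tensor K M N\<^esub> t = t \<oplus>\<^bsub>tensor K M N\<^esub> s"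
    if "s \<in> carrier (tensor K M N)" "t \<in> carrier (tensor K M N)" for s t
    using that by (elim tensor_classE)
      (simp add: add_tensor_class tensor_class_eq[OF tensor_rel_append_commute])
  show "\<exists>t \<in> carrier (tensor K M N). t \<oplus>\<^bsub>tensor K M N\<^esub> s = \<zero>\<^bsub>tensor K M N\<^esub>"
    if "s \<in> carrier (tensor K M N)" for s
    using that
  proof (induction s rule: tensor_induct)
    case zero
    show ?case using l_zero tensor_class_closed[of "[]"] by (auto simp: tensor_class_Nil)
  next
    case (add a b s)
    then obtain t where t: "t \<in> carrier (tensor K M N)" "t \<oplus>\<^bsub>tensor K M N\<^esub> s = \<zero>\<^bsub>tensor K M N\<^esub>"
      by blast
    \<comment> \<open>The relation \<open>0 \<otimes> b = 0\<close> makes \<open>(- a) \<otimes> b\<close> an inverse of \<open>a \<otimes> b\<close>.\<close>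
    define p p' where "p = pure_tensor K M N a b" and "p' = pure_tensor K M N (\<ominus>\<^bsub>M\<^esub> a) b"
    have p: "p \<in> carrier (tensor K M N)" "p' \<in> carrier (tensor K M N)"
      using add by (simp_all add: p_def p'_def)
    have "p' \<oplus>\<^bsub>tensor K M N\<^esub> p = \<zero>\<^bsub>tensor K M N\<^esub>"
      using add by (simp add: p_def p'_def M.M.l_neg pure_tensor_zero_left flip: pure_tensor_add_left)
    then have "(t \<oplus>\<^bsub>tensor K M N\<^esub> p') \<oplus>\<^bsub>tensor K M N\<^esub> (p \<oplus>\<^bsub>tensor K M N\<^esub> s) = \<zero>\<^bsub>tensor K M N\<^esub>"
      using add t p by (metis assoc closed l_zero)
    then show ?case using t p closed unfolding p_def by blast
  qed
qed

lemma tensor_module: "module K (tensor K M N)"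
proof -
  interpret T: abelian_group "tensor K M N" by (rule tensor_abelian_group)
  have closed: "c \<odot>\<^bsub>tensor K M N\<^esub> t \<in> carrier (tensor K M N)"
    if "c \<in> carrier K" "t \<in> carrier (tensor K M N)" for c t
    using that by (elim tensor_classE) (simp add: smult_tensor_class tensor_class_closed map_smult_lists del: in_lists_conv_set)
  have zero: "c \<odot>\<^bsub>tensor K M N\<^esub> \<zero>\<^bsub>tensor K M N\<^esub> = \<zero>\<^bsub>tensor K M N\<^esub>" if "c \<in> carrier K" for c
    using that by (simp add: smult_tensor_class flip: tensor_class_Nil)
  have add: "c \<odot>\<^bsub>tensor K M N\<^esub> (s \<oplus>\<^bsub>tensor K M N\<^esub> t) =
      c \<odot>\<^bsub>tensor K M N\<^esub> s \<oplus>\<^bsub>tensor K M N\<^esub> c \<odot>\<^bsub>tensor K M N\<^esub> t"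
    if "c \<in> carrier K" "s \<in> carrier (tensor K M N)" "t \<in> carrier (tensor K M N)" for c s t
    using that by (elim tensor_classE)
      (simp add: add_tensor_class smult_tensor_class map_smult_lists del: in_lists_conv_set)
  show ?thesis
  proof (rule moduleI)
    show "cring K" ..
    show "abelian_group (tensor K M N)" ..
    show "c \<odot>\<^bsub>tensor K M N\<^esub> t \<in> carrier (tensor K M N)"
      if "c \<in> carrier K" "t \<in> carrier (tensor K M N)" for c t
      using that by (rule closed)
    show "c \<odot>\<^bsub>tensor K M N\<^esub> (s \<oplus>\<^bsub>tensor K M N\<^esub> t) =
        c \<odot>\<^bsub>tensor K M N\<^esub> s \<oplus>\<^bsub>tensor K M N\<^esub> c \<odot>\<^bsub>tensor K M N\<^esub> t"
      if "c \<in> carrier K" "s \<in> carrier (tensor K M N)" "t \<in> carrier (tensor K M N)" for c s t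
      using that by (rule add)
    show "(c \<oplus> d) \<odot>\<^bsub>tensor K M N\<^esub> t = c \<odot>\<^bsub>tensor K M N\<^esub> t \<oplus>\<^bsub>tensor K M N\<^esub> d \<odot>\<^bsub>tensor K M N\<^esub> t"
      if "c \<in> carrier K" "d \<in> carrier K" "t \<in> carrier (tensor K M N)" for c d t
      using that(3)
      by (induction rule: tensor_induct)
        (use that(1,2) in \<open>simp_all add: zero add closed smult_pure_tensor M.smult_l_distr
          pure_tensor_add_left T.a_ac\<close>)
    show "(c \<otimes> d) \<odot>\<^bsub>tensor K M N\<^esub> t = c \<odot>\<^bsub>tensor K M N\<^esub> (d \<odot>\<^bsub>tensor K M N\<^esub> t)"
      if "c \<in> carrier K" "d \<in> carrier K" "t \<in> carrier (tensor K M N)" for c d t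
      using that(3)
      by (induction rule: tensor_induct)
        (use that(1,2) in \<open>simp_all add: zero add closed smult_pure_tensor M.smult_assoc1\<close>)
    show "\<one> \<odot>\<^bsub>tensor K M N\<^esub> t = t" if "t \<in> carrier (tensor K M N)" for t
      using that by (induction rule: tensor_induct) (simp_all add: zero add smult_pure_tensor)
  qed
qed

end


section \<open>Bilinear maps and the universal property\<close>

lemma linear_mapsI:
  assumes "\<And>x. x \<in> carrier M \<Longrightarrow> f x \<in> carrier N"
    and "\<And>x y. x \<in> carrier M \<Longrightarrow> y \<in> carrier M \<Longrightarrow> f (x \<oplus>\<^bsub>M\<^esub> y) = f x \<oplus>\<^bsub>N\<^esub> f y"
    and "\<And>c x. c \<in> carrier K \<Longrightarrow> x \<in> carrier M \<Longrightarrow> f (c \<odot>\<^bsub>M\<^esub> x) = c \<odot>\<^bsub>N\<^esub> f x"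
  shows "f \<in> linear_maps K M N"
  using assms by (simp add: linear_maps_def)

lemma linear_mapsD:
  assumes "f \<in> linear_maps K M N"
  shows linear_maps_closed: "x \<in> carrier M \<Longrightarrow> f x \<in> carrier N"
    and linear_maps_add: "x \<in> carrier M \<Longrightarrow> y \<in> carrier M \<Longrightarrow> f (x \<oplus>\<^bsub>M\<^esub> y) = f x \<oplus>\<^bsub>N\<^esub> f y"
    and linear_maps_smult: "c \<in> carrier K \<Longrightarrow> x \<in> carrier M \<Longrightarrow> f (c \<odot>\<^bsub>M\<^esub> x) = c \<odot>\<^bsub>N\<^esub> f x"
  using assms by (auto simp: linear_maps_def)

lemma linear_maps_zero:
  assumes "module K M" "module K N" "f \<in> linear_maps K M N"
  shows "f \<zero>\<^bsub>M\<^esub> = \<zero>\<^bsub>N\<^esub>"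
proof -
  interpret M: module K M by fact
  interpret N: module K N by fact
  have "f (\<zero>\<^bsub>K\<^esub> \<odot>\<^bsub>M\<^esub> \<zero>\<^bsub>M\<^esub>) = \<zero>\<^bsub>K\<^esub> \<odot>\<^bsub>N\<^esub> f \<zero>\<^bsub>M\<^esub>"
    by (intro linear_maps_smult[OF assms(3)]) auto
  then show ?thesis using linear_maps_closed[OF assms(3)] by simp
qed

lemma linear_maps_comp:
  assumes "f \<in> linear_maps K M N" "g \<in> linear_maps K N P"
  shows "(\<lambda>x. g (f x)) \<in> linear_maps K M P"
  using assms by (auto simp: linear_maps_def Pi_iff)

lemma linear_maps_ident: "(\<lambda>x. x) \<in> linear_maps K M M"
  by (simp add: linear_maps_def)

lemma linear_maps_cong:
  assumes "f \<in> linear_maps K M N" "module K M" "\<And>x. x \<in> carrier M \<Longrightarrow> g x = f x"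
  shows "g \<in> linear_maps K M N"
proof -
  interpret M: module K M by fact
  show ?thesis using assms(1,3) by (auto simp: linear_maps_def)
qed

definition bilinear_maps ::
  "('k, 'x) ring_scheme \<Rightarrow> ('k, 'm, 'y) module_scheme \<Rightarrow> ('k, 'n, 'z) module_scheme \<Rightarrow>
   ('k, 'p, 'w) module_scheme \<Rightarrow> ('m \<Rightarrow> 'n \<Rightarrow> 'p) set"
where
  "bilinear_maps K M N P = {\<beta>. (\<forall>a \<in> carrier M. \<beta> a \<in> linear_maps K N P) \<and>
     (\<forall>b \<in> carrier N. (\<lambda>a. \<beta> a b) \<in> linear_maps K M P)}"

lemma bilinear_mapsI:
  assumes "\<And>a. a \<in> carrier M \<Longrightarrow> (\<lambda>b. \<beta> a b) \<in> linear_maps K N P"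
    and "\<And>b. b \<in> carrier N \<Longrightarrow> (\<lambda>a. \<beta> a b) \<in> linear_maps K M P"
  shows "\<beta> \<in> bilinear_maps K M N P"
  using assms by (simp add: bilinear_maps_def)

lemma bilinear_maps_left: "\<beta> \<in> bilinear_maps K M N P \<Longrightarrow> b \<in> carrier N \<Longrightarrow> (\<lambda>a. \<beta> a b) \<in> linear_maps K M P"
  and bilinear_maps_right: "\<beta> \<in> bilinear_maps K M N P \<Longrightarrow> a \<in> carrier M \<Longrightarrow> (\<lambda>b. \<beta> a b) \<in> linear_maps K N P"
  by (simp_all add: bilinear_maps_def)

lemma bilinear_maps_closed:
  assumes "\<beta> \<in> bilinear_maps K M N P" "a \<in> carrier M" "b \<in> carrier N"
  shows "\<beta> a b \<in> carrier P"
  using linear_maps_closed[OF bilinear_maps_left[OF assms(1,3)] assms(2)] .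

lemma bilinear_maps_comp_linear:
  assumes "f \<in> linear_maps K M M'" "g \<in> linear_maps K N N'" "\<beta> \<in> bilinear_maps K M' N' P"
  shows "(\<lambda>a b. \<beta> (f a) (g b)) \<in> bilinear_maps K M N P"
proof (rule bilinear_mapsI)
  show "(\<lambda>b. \<beta> (f a) (g b)) \<in> linear_maps K N P" if "a \<in> carrier M" for a
    using linear_maps_comp[OF assms(2) bilinear_maps_right[OF assms(3) linear_maps_closed[OF assms(1) that]]] .
  show "(\<lambda>a. \<beta> (f a) (g b)) \<in> linear_maps K M P" if "b \<in> carrier N" for b
    using linear_maps_comp[OF assms(1) bilinear_maps_left[OF assms(3) linear_maps_closed[OF assms(2) that]]] .
qed

lemma linear_comp_bilinear_maps:
  assumes "\<beta> \<in> bilinear_maps K M N P" "g \<in> linear_maps K P Q"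
  shows "(\<lambda>a b. g (\<beta> a b)) \<in> bilinear_maps K M N Q"
proof (rule bilinear_mapsI)
  show "(\<lambda>b. g (\<beta> a b)) \<in> linear_maps K N Q" if "a \<in> carrier M" for a
    using linear_maps_comp[OF bilinear_maps_right[OF assms(1) that] assms(2)] .
  show "(\<lambda>a. g (\<beta> a b)) \<in> linear_maps K M Q" if "b \<in> carrier N" for b
    using linear_maps_comp[OF bilinear_maps_left[OF assms(1) that] assms(2)] .
qed

lemma bilinear_maps_cong:
  assumes "\<beta> \<in> bilinear_maps K M N P" "module K M" "module K N"
    "\<And>a b. a \<in> carrier M \<Longrightarrow> b \<in> carrier N \<Longrightarrow> \<gamma> a b = \<beta> a b"
  shows "\<gamma> \<in> bilinear_maps K M N P"
proof (rule bilinear_mapsI)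
  show "\<gamma> a \<in> linear_maps K N P" if "a \<in> carrier M" for a
    by (rule linear_maps_cong[OF bilinear_maps_right[OF assms(1) that] assms(3) assms(4)[OF that]])
  show "(\<lambda>a. \<gamma> a b) \<in> linear_maps K M P" if "b \<in> carrier N" for b
    by (rule linear_maps_cong[OF bilinear_maps_left[OF assms(1) that] assms(2) assms(4)[OF _ that]])
qed

lemma module_tensor: "module K M \<Longrightarrow> module K N \<Longrightarrow> module K (tensor K M N)"
  by (simp add: module_pair.tensor_module module_pair_def)

lemma pure_tensor_bilinear:
  assumes "module K M" "module K N"
  shows "pure_tensor K M N \<in> bilinear_maps K M N (tensor K M N)"
proof -
  interpret module_pair K M N by (simp add: module_pair_def assms)
  show ?thesis
    by (intro bilinear_mapsI linear_mapsI)
      (simp_all add: pure_tensor_add_left pure_tensor_add_right pure_tensor_smult_right smult_pure_tensor)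
qed

locale tensor_to_module = module_pair K M N + P: module K P for K (structure) and M and N and P
begin

abbreviation sum_over where
  "sum_over \<beta> xs \<equiv> foldr (\<lambda>(a, b) s. \<beta> a b \<oplus>\<^bsub>P\<^esub> s) xs \<zero>\<^bsub>P\<^esub>"

lemma sum_over_closed:
  assumes "\<beta> \<in> bilinear_maps K M N P" "xs \<in> lists (carrier M \<times> carrier N)"
  shows "sum_over \<beta> xs \<in> carrier P"
  using assms(2) by (induction xs) (auto simp: bilinear_maps_closed[OF assms(1)])

lemma sum_over_append:
  assumes "\<beta> \<in> bilinear_maps K M N P"
    "xs \<in> lists (carrier M \<times> carrier N)" "ys \<in> lists (carrier M \<times> carrier N)"
  shows "sum_over \<beta> (xs @ ys) = sum_over \<beta> xs \<oplus>\<^bsub>P\<^esub> sum_over \<beta> ys"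
  using assms(2)
proof (induction xs)
  case Nil
  then show ?case using sum_over_closed[OF assms(1,3)] by simp
next
  case (Cons p xs)
  then show ?case
    using sum_over_closed[OF assms(1,3)] sum_over_closed[OF assms(1), of xs]
    by (cases p) (auto simp: bilinear_maps_closed[OF assms(1)] P.M.a_assoc simp del: foldr_append)
qed

text \<open>
  Each generating relation of the tensor product is an instance of bilinearity of \<open>\<beta>\<close> or of
  commutativity in \<open>P\<close>. Hence the sums over all representatives of a tensor form a singleton, as
  \<^const>\<open>the_elem\<close> in the definition of \<^const>\<open>tensor_lift\<close> requires.
\<close>

lemma sum_over_tensor_rel:
  assumes "\<beta> \<in> bilinear_maps K M N P" "(xs, ys) \<in> tensor_rel K M N"
  shows "sum_over \<beta> xs = sum_over \<beta> ys"
  using assms(2)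
proof (induction rule: tensor_rel.induct)
  case (append xs ys xs' ys')
  then show ?case
    using tensor_rel_carrier by (simp add: sum_over_append[OF assms(1)] del: in_lists_conv_set foldr_append)
next
  case (swap p q)
  then show ?case
    by (auto simp: bilinear_maps_closed[OF assms(1)] P.M.a_comm)
next
  case (zero b)
  then show ?case
    using linear_maps_zero[OF M.module_axioms P.module_axioms bilinear_maps_left[OF assms(1)]] by simp
next
  case (add_left a a' b)
  then show ?case
    by (simp add: bilinear_maps_closed[OF assms(1)] linear_maps_add[OF bilinear_maps_left[OF assms(1)]])
next
  case (add_right a b b')
  then show ?case
    by (simp add: bilinear_maps_closed[OF assms(1)] linear_maps_add[OF bilinear_maps_right[OF assms(1)]])
next
  case (smult c a b)
  then show ?case
    by (simp add: linear_maps_smult[OF bilinear_maps_left[OF assms(1)]]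
        linear_maps_smult[OF bilinear_maps_right[OF assms(1)]])
qed simp_all

lemma tensor_lift_class:
  assumes "\<beta> \<in> bilinear_maps K M N P" "xs \<in> lists (carrier M \<times> carrier N)"
  shows "tensor_lift P \<beta> (tensor_class K M N xs) = sum_over \<beta> xs"
proof -
  have "sum_over \<beta> ys = sum_over \<beta> xs" if "ys \<in> tensor_class K M N xs" for ys
    using that by (intro sum_over_tensor_rel[OF assms(1), symmetric]) (simp add: tensor_class_def)
  moreover have "xs \<in> tensor_class K M N xs"
    using tensor_rel.refl[OF assms(2)] by (simp add: tensor_class_def)
  ultimately have "sum_over \<beta> ` tensor_class K M N xs = {sum_over \<beta> xs}"
    by blast
  then show ?thesis by (simp add: tensor_lift_def)
qed

lemma tensor_lift_zero_tensor:
  assumes "\<beta> \<in> bilinear_maps K M N P"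
  shows "tensor_lift P \<beta> \<zero>\<^bsub>tensor K M N\<^esub> = \<zero>\<^bsub>P\<^esub>"
  using tensor_lift_class[OF assms, of "[]"] by (simp add: tensor_class_Nil)

lemma tensor_lift_linear:
  assumes "\<beta> \<in> bilinear_maps K M N P"
  shows "tensor_lift P \<beta> \<in> linear_maps K (tensor K M N) P"
proof (rule linear_mapsI)
  fix s t assume "s \<in> carrier (tensor K M N)" "t \<in> carrier (tensor K M N)"
  then show "tensor_lift P \<beta> (s \<oplus>\<^bsub>tensor K M N\<^esub> t) = tensor_lift P \<beta> s \<oplus>\<^bsub>P\<^esub> tensor_lift P \<beta> t"
    by (elim tensor_classE)
      (simp add: add_tensor_class tensor_lift_class[OF assms] sum_over_append[OF assms]
        del: in_lists_conv_set foldr_append)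
next
  fix t assume "t \<in> carrier (tensor K M N)"
  then show "tensor_lift P \<beta> t \<in> carrier P"
    by (elim tensor_classE)
      (simp add: tensor_lift_class[OF assms] sum_over_closed[OF assms] del: in_lists_conv_set)
next
  fix c t assume c: "c \<in> carrier K" and "t \<in> carrier (tensor K M N)"
  then obtain xs where xs: "xs \<in> lists (carrier M \<times> carrier N)" "t = tensor_class K M N xs"
    by (blast elim: tensor_classE)
  have "sum_over \<beta> (map (\<lambda>(a, b). (c \<odot>\<^bsub>M\<^esub> a, b)) xs) = c \<odot>\<^bsub>P\<^esub> sum_over \<beta> xs"
    using xs(1)
  proof (induction xs)
    case Nil
    then show ?case using c by simp
  next
    case (Cons p xs)
    then show ?case
      using c sum_over_closed[OF assms, of xs]
      by (cases p) (auto simp: P.smult_r_distr bilinear_maps_closed[OF assms]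
        linear_maps_smult[OF bilinear_maps_left[OF assms]])
  qed
  then show "tensor_lift P \<beta> (c \<odot>\<^bsub>tensor K M N\<^esub> t) = c \<odot>\<^bsub>P\<^esub> tensor_lift P \<beta> t"
    using c xs
    by (simp add: smult_tensor_class tensor_lift_class[OF assms] map_smult_lists del: in_lists_conv_set)
qed

lemma tensor_lift_pure:
  assumes "\<beta> \<in> bilinear_maps K M N P" "a \<in> carrier M" "b \<in> carrier N"
  shows "tensor_lift P \<beta> (pure_tensor K M N a b) = \<beta> a b"
  using assms(2,3)
  by (simp add: pure_tensor_def tensor_lift_class[OF assms(1)] bilinear_maps_closed[OF assms(1)])

lemma linear_maps_tensor_eqI:
  assumes "f \<in> linear_maps K (tensor K M N) P" "g \<in> linear_maps K (tensor K M N) P"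
    and "\<And>a b. a \<in> carrier M \<Longrightarrow> b \<in> carrier N \<Longrightarrow> f (pure_tensor K M N a b) = g (pure_tensor K M N a b)"
    and "t \<in> carrier (tensor K M N)"
  shows "f t = g t"
  using assms(4)
proof (induction t rule: tensor_induct)
  case zero
  show ?case
    by (simp add: linear_maps_zero[OF tensor_module P.module_axioms assms(1)]
        linear_maps_zero[OF tensor_module P.module_axioms assms(2)])
next
  case (add a b t)
  then show ?case
    by (simp add: linear_maps_add[OF assms(1)] linear_maps_add[OF assms(2)] assms(3))
qed

lemma tensor_lift_eq:
  assumes "\<And>a b. a \<in> carrier M \<Longrightarrow> b \<in> carrier N \<Longrightarrow> f (pure_tensor K M N a b) = \<beta> a b"
    and "f \<in> linear_maps K (tensor K M N) P" "\<beta> \<in> bilinear_maps K M N P"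
    and "t \<in> carrier (tensor K M N)"
  shows "tensor_lift P \<beta> t = f t"
  by (rule linear_maps_tensor_eqI[OF tensor_lift_linear[OF assms(3)] assms(2) _ assms(4)])
    (simp add: assms(1) tensor_lift_pure[OF assms(3)])

lemma tensor_lift_cong:
  assumes "\<And>a b. a \<in> carrier M \<Longrightarrow> b \<in> carrier N \<Longrightarrow> \<beta> a b = \<gamma> a b" "t \<in> carrier (tensor K M N)"
  shows "tensor_lift P \<beta> t = tensor_lift P \<gamma> t"
proof -
  have "sum_over \<beta> xs = sum_over \<gamma> xs" if "xs \<in> t" for xs
  proof -
    obtain ys where "t = tensor_class K M N ys"
      using assms(2) by (rule tensor_classE)
    with that have "(ys, xs) \<in> tensor_rel K M N" by (simp add: tensor_class_def)
    then have "xs \<in> lists (carrier M \<times> carrier N)" using tensor_rel_carrier by blast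
    then show ?thesis by (induction xs) (auto simp: assms(1))
  qed
  then show ?thesis by (simp add: tensor_lift_def cong: image_cong)
qed

text \<open>
  Iterated Sweedler sums, as in coassociativity and in the product of tensors, are lifts of maps that
  are themselves given by lifts. Linearity of the inner lift in its parameter makes the outer one
  meaningful.
\<close>

lemma tensor_lift_linear_param:
  assumes t: "t \<in> carrier (tensor K M N)" and U: "module K U"
    and bil: "\<And>u. u \<in> carrier U \<Longrightarrow> \<beta> u \<in> bilinear_maps K M N P"
    and lin: "\<And>a b. a \<in> carrier M \<Longrightarrow> b \<in> carrier N \<Longrightarrow> (\<lambda>u. \<beta> u a b) \<in> linear_maps K U P"
  shows "(\<lambda>u. tensor_lift P (\<beta> u) t) \<in> linear_maps K U P"
proof -
  interpret U: module K U by fact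
  interpret T: module K "tensor K M N" by (rule tensor_module)
  note closed = linear_maps_closed[OF tensor_lift_linear[OF bil]] linear_maps_closed[OF lin]
  note step = linear_maps_add[OF tensor_lift_linear[OF bil]] tensor_lift_pure[OF bil] tensor_lift_zero_tensor[OF bil]
  show ?thesis
  proof (rule linear_mapsI)
    fix u assume "u \<in> carrier U"
    then show "tensor_lift P (\<beta> u) t \<in> carrier P" by (simp add: closed t)
  next
    fix u v assume uv: "u \<in> carrier U" "v \<in> carrier U"
    show "tensor_lift P (\<beta> (u \<oplus>\<^bsub>U\<^esub> v)) t = tensor_lift P (\<beta> u) t \<oplus>\<^bsub>P\<^esub> tensor_lift P (\<beta> v) t"
      using t by (induction rule: tensor_induct)
        (use uv in \<open>simp_all add: step closed linear_maps_add[OF lin] P.M.a_ac\<close>)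
  next
    fix c u assume cu: "c \<in> carrier K" "u \<in> carrier U"
    show "tensor_lift P (\<beta> (c \<odot>\<^bsub>U\<^esub> u)) t = c \<odot>\<^bsub>P\<^esub> tensor_lift P (\<beta> u) t"
      using t by (induction rule: tensor_induct)
        (use cu in \<open>simp_all add: step closed linear_maps_smult[OF lin] P.smult_r_distr\<close>)
  qed
qed

end

lemma linear_comp_tensor_lift:
  assumes "module K M" "module K N" "module K P" "module K Q"
    and \<beta>: "\<beta> \<in> bilinear_maps K M N P" and f: "f \<in> linear_maps K P Q"
    and t: "t \<in> carrier (tensor K M N)"
  shows "f (tensor_lift P \<beta> t) = tensor_lift Q (\<lambda>a b. f (\<beta> a b)) t"
proof -
  interpret P: tensor_to_module K M N P by (simp add: tensor_to_module_def module_pair_def assms)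
  interpret Q: tensor_to_module K M N Q by (simp add: tensor_to_module_def module_pair_def assms)
  show ?thesis
    by (rule Q.tensor_lift_eq[OF _ linear_maps_comp[OF P.tensor_lift_linear[OF \<beta>] f]
      linear_comp_bilinear_maps[OF \<beta> f] t, symmetric]) (simp add: P.tensor_lift_pure[OF \<beta>])
qed

text \<open>
  The last part is the substitution rule for Sweedler sums: applying \<open>f \<otimes> g\<close> before evaluating a
  bilinear map is the same as substituting \<open>f\<close> and \<open>g\<close> into its arguments.
\<close>

lemma
  assumes "module K M" "module K N" "module K M'" "module K N'"
    and f: "f \<in> linear_maps K M M'" and g: "g \<in> linear_maps K N N'"
  shows tensor_map_linear: "tensor_map K M' N' f g \<in> linear_maps K (tensor K M N) (tensor K M' N')"
    and tensor_map_pure: "a \<in> carrier M \<Longrightarrow> b \<in> carrier N \<Longrightarrow>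
      tensor_map K M' N' f g (pure_tensor K M N a b) = pure_tensor K M' N' (f a) (g b)"
    and tensor_lift_tensor_map: "\<lbrakk>module K P; \<beta> \<in> bilinear_maps K M' N' P; t \<in> carrier (tensor K M N)\<rbrakk> \<Longrightarrow>
      tensor_lift P \<beta> (tensor_map K M' N' f g t) = tensor_lift P (\<lambda>a b. \<beta> (f a) (g b)) t"
proof -
  have T': "module K (tensor K M' N')" by (intro module_tensor assms)
  interpret T: tensor_to_module K M N "tensor K M' N'"
    by (simp add: tensor_to_module_def module_pair_def assms T')
  note bil = bilinear_maps_comp_linear[OF f g pure_tensor_bilinear[OF assms(3,4)]]
  show lin: "tensor_map K M' N' f g \<in> linear_maps K (tensor K M N) (tensor K M' N')"
    unfolding tensor_map_def by (rule T.tensor_lift_linear[OF bil])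
  show "tensor_map K M' N' f g (pure_tensor K M N a b) = pure_tensor K M' N' (f a) (g b)"
    if "a \<in> carrier M" "b \<in> carrier N" for a b
    unfolding tensor_map_def by (rule T.tensor_lift_pure[OF bil that])
  show "tensor_lift P \<beta> (tensor_map K M' N' f g t) = tensor_lift P (\<lambda>a b. \<beta> (f a) (g b)) t"
    if "module K P" "\<beta> \<in> bilinear_maps K M' N' P" "t \<in> carrier (tensor K M N)" for P \<beta> t
  proof -
    interpret P: tensor_to_module K M' N' P by (simp add: tensor_to_module_def module_pair_def assms that)
    have "tensor_lift P \<beta> (tensor_map K M' N' f g t) =
        tensor_lift P (\<lambda>a b. tensor_lift P \<beta> (pure_tensor K M' N' (f a) (g b))) t"
      unfolding tensor_map_def
      by (intro linear_comp_tensor_lift[OF assms(1,2) T' that(1) bil _ that(3)]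
        P.tensor_lift_linear that(2))
    also have "\<dots> = tensor_lift P (\<lambda>a b. \<beta> (f a) (g b)) t"
      by (intro tensor_to_module.tensor_lift_cong[of K M N P] that(3) P.tensor_lift_pure that(2)
        linear_maps_closed[OF f] linear_maps_closed[OF g])
        (simp add: tensor_to_module_def module_pair_def assms that)
    finally show ?thesis .
  qed
qed


section \<open>The product on a tensor product of algebras\<close>

lemma assoc_algebra_module: "assoc_algebra K A \<Longrightarrow> module K A"
  by (simp add: assoc_algebra_def)

lemma mult_bilinear:
  assumes "assoc_algebra K A"
  shows "(\<lambda>x y. x \<otimes>\<^bsub>A\<^esub> y) \<in> bilinear_maps K A A A"
proof -
  interpret assoc_algebra K A by fact
  show ?thesis
    by (intro bilinear_mapsI linear_mapsI)
      (simp_all add: A.l_distr A.r_distr smult_mult_left smult_mult_right)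
qed

locale algebra_pair = A: assoc_algebra K A + B: assoc_algebra K B for K (structure) and A and B
begin

sublocale module_pair K A B
  by (simp add: module_pair_def assoc_algebra_module A.assoc_algebra_axioms B.assoc_algebra_axioms)

sublocale T: tensor_to_module K A B "tensor K A B"
  by (simp add: tensor_to_module_def module_pair_axioms tensor_module)

abbreviation tensor_mult where
  "tensor_mult s t \<equiv> tensor_lift (tensor K A B) (\<lambda>a b.
     tensor_lift (tensor K A B) (\<lambda>c d. pure_tensor K A B (a \<otimes>\<^bsub>A\<^esub> c) (b \<otimes>\<^bsub>B\<^esub> d)) t) s"

lemma pure_mult_bilinear:
  assumes "a \<in> carrier A" "b \<in> carrier B"
  shows "(\<lambda>c d. pure_tensor K A B (a \<otimes>\<^bsub>A\<^esub> c) (b \<otimes>\<^bsub>B\<^esub> d)) \<in> bilinear_maps K A B (tensor K A B)"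
  by (rule bilinear_maps_comp_linear[OF
      bilinear_maps_right[OF mult_bilinear[OF A.assoc_algebra_axioms] assms(1)]
      bilinear_maps_right[OF mult_bilinear[OF B.assoc_algebra_axioms] assms(2)]
      pure_tensor_bilinear[OF A.module_axioms B.module_axioms]])

lemma pure_mult_bilinear':
  assumes "c \<in> carrier A" "d \<in> carrier B"
  shows "(\<lambda>a b. pure_tensor K A B (a \<otimes>\<^bsub>A\<^esub> c) (b \<otimes>\<^bsub>B\<^esub> d)) \<in> bilinear_maps K A B (tensor K A B)"
  by (rule bilinear_maps_comp_linear[OF
      bilinear_maps_left[OF mult_bilinear[OF A.assoc_algebra_axioms] assms(1)]
      bilinear_maps_left[OF mult_bilinear[OF B.assoc_algebra_axioms] assms(2)]
      pure_tensor_bilinear[OF A.module_axioms B.module_axioms]])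

lemma tensor_mult_inner_bilinear:
  assumes t: "t \<in> carrier (tensor K A B)"
  shows "(\<lambda>a b. tensor_lift (tensor K A B)
      (\<lambda>c d. pure_tensor K A B (a \<otimes>\<^bsub>A\<^esub> c) (b \<otimes>\<^bsub>B\<^esub> d)) t) \<in> bilinear_maps K A B (tensor K A B)"
proof (rule bilinear_mapsI)
  show "(\<lambda>b. tensor_lift (tensor K A B)
      (\<lambda>c d. pure_tensor K A B (a \<otimes>\<^bsub>A\<^esub> c) (b \<otimes>\<^bsub>B\<^esub> d)) t) \<in> linear_maps K B (tensor K A B)"
    if "a \<in> carrier A" for a
    by (rule T.tensor_lift_linear_param[OF t B.module_axioms])
      (use that pure_mult_bilinear bilinear_maps_right[OF pure_mult_bilinear'] in auto)
  show "(\<lambda>a. tensor_lift (tensor K A B)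
      (\<lambda>c d. pure_tensor K A B (a \<otimes>\<^bsub>A\<^esub> c) (b \<otimes>\<^bsub>B\<^esub> d)) t) \<in> linear_maps K A (tensor K A B)"
    if "b \<in> carrier B" for b
    by (rule T.tensor_lift_linear_param[OF t A.module_axioms])
      (use that pure_mult_bilinear bilinear_maps_left[OF pure_mult_bilinear'] in auto)
qed

lemma tensor_mult_bilinear: "tensor_mult \<in> bilinear_maps K (tensor K A B) (tensor K A B) (tensor K A B)"
proof (rule bilinear_mapsI)
  show "tensor_mult s \<in> linear_maps K (tensor K A B) (tensor K A B)"
    if "s \<in> carrier (tensor K A B)" for s
    by (rule T.tensor_lift_linear_param[OF that tensor_module tensor_mult_inner_bilinear])
      (simp_all add: T.tensor_lift_linear pure_mult_bilinear)
  show "(\<lambda>s. tensor_mult s t) \<in> linear_maps K (tensor K A B) (tensor K A B)"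
    if "t \<in> carrier (tensor K A B)" for t
    by (rule T.tensor_lift_linear[OF tensor_mult_inner_bilinear[OF that]])
qed

text \<open>
  The product of formal sums is the double sum over both lists, hence an iterated lift. Since lifts
  depend only on the class of a list, this shows at once that the product of tensors is well defined
  and bilinear, without a direct check of the generating relations.
\<close>

lemma tensor_class_mult:
  assumes xs: "xs \<in> lists (carrier A \<times> carrier B)" and ys: "ys \<in> lists (carrier A \<times> carrier B)"
  shows "tensor_class K A B [(a \<otimes>\<^bsub>A\<^esub> c, b \<otimes>\<^bsub>B\<^esub> d). (a, b) \<leftarrow> xs, (c, d) \<leftarrow> ys] =
    tensor_mult (tensor_class K A B xs) (tensor_class K A B ys)"
proof -
  let ?row = "\<lambda>a b ys. map (\<lambda>(c, d). (a \<otimes>\<^bsub>A\<^esub> c, b \<otimes>\<^bsub>B\<^esub> d)) ys"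
  have row_closed: "?row a b ys \<in> lists (carrier A \<times> carrier B)"
    if "ys \<in> lists (carrier A \<times> carrier B)" "a \<in> carrier A" "b \<in> carrier B" for a b ys
    using that(1) by (induction ys) (use that(2,3) in auto)
  have row: "tensor_class K A B (?row a b ys) = T.sum_over
      (\<lambda>c d. pure_tensor K A B (a \<otimes>\<^bsub>A\<^esub> c) (b \<otimes>\<^bsub>B\<^esub> d)) ys"
    if ab: "a \<in> carrier A" "b \<in> carrier B" for a b
    using ys
  proof (induction ys)
    case Nil
    then show ?case by (simp add: tensor_class_Nil)
  next
    case (Cons q ys)
    with row_closed[OF _ ab, of ys] ab show ?case
      by (cases q) (auto simp: tensor_class_Cons simp del: in_lists_conv_set)
  qed
  have "tensor_class K A B [(a \<otimes>\<^bsub>A\<^esub> c, b \<otimes>\<^bsub>B\<^esub> d). (a, b) \<leftarrow> xs, (c, d) \<leftarrow> ys] =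
      T.sum_over (\<lambda>a b. tensor_lift (tensor K A B)
        (\<lambda>c d. pure_tensor K A B (a \<otimes>\<^bsub>A\<^esub> c) (b \<otimes>\<^bsub>B\<^esub> d)) (tensor_class K A B ys)) xs \<and>
      [(a \<otimes>\<^bsub>A\<^esub> c, b \<otimes>\<^bsub>B\<^esub> d). (a, b) \<leftarrow> xs, (c, d) \<leftarrow> ys] \<in> lists (carrier A \<times> carrier B)"
    using xs
  proof (induction xs)
    case Nil
    then show ?case by (simp add: tensor_class_Nil)
  next
    case (Cons p xs)
    obtain a b where p: "p = (a, b)" "a \<in> carrier A" "b \<in> carrier B"
      using Cons by auto
    have "tensor_class K A B (?row a b ys) = tensor_lift (tensor K A B)
        (\<lambda>c d. pure_tensor K A B (a \<otimes>\<^bsub>A\<^esub> c) (b \<otimes>\<^bsub>B\<^esub> d)) (tensor_class K A B ys)"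
      using p by (simp add: row T.tensor_lift_class[OF pure_mult_bilinear ys])
    with Cons p row_closed[OF ys, of a b] show ?case
      by (simp add: add_tensor_class[symmetric] del: in_lists_conv_set)
  qed
  then show ?thesis
    by (simp add: T.tensor_lift_class[OF tensor_mult_inner_bilinear] xs tensor_class_closed ys
        del: in_lists_conv_set)
qed

lemma tensor_mult_eq:
  assumes "s \<in> carrier (tensor K A B)" "t \<in> carrier (tensor K A B)"
  shows "s \<otimes>\<^bsub>tensor K A B\<^esub> t = tensor_mult s t"
proof -
  obtain xs ys where xs: "xs \<in> lists (carrier A \<times> carrier B)" "s = tensor_class K A B xs"
    and ys: "ys \<in> lists (carrier A \<times> carrier B)" "t = tensor_class K A B ys"
    using tensor_classE[OF assms(1)] tensor_classE[OF assms(2)] by metis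
  have "tensor_class K A B [(a \<otimes>\<^bsub>A\<^esub> c, b \<otimes>\<^bsub>B\<^esub> d). (a, b) \<leftarrow> xs', (c, d) \<leftarrow> ys'] = tensor_mult s t"
    if "(xs, xs') \<in> tensor_rel K A B" "(ys, ys') \<in> tensor_rel K A B" for xs' ys'
  proof -
    have "xs' \<in> lists (carrier A \<times> carrier B)" "ys' \<in> lists (carrier A \<times> carrier B)"
      using tensor_rel_carrier that by blast+
    then show ?thesis
      using tensor_class_mult[of xs' ys'] tensor_class_eq[OF that(1)] tensor_class_eq[OF that(2)]
      by (simp add: xs ys del: in_lists_conv_set)
  qed
  then have "(\<Union>xs \<in> s. \<Union>ys \<in> t. tensor_class K A B
      [(a \<otimes>\<^bsub>A\<^esub> c, b \<otimes>\<^bsub>B\<^esub> d). (a, b) \<leftarrow> xs, (c, d) \<leftarrow> ys]) = tensor_mult s t"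
    unfolding xs(2) ys(2) by (intro UN_tensor_class xs(1) ys(1)) auto
  then show ?thesis by (simp add: tensor_def)
qed

lemma pure_tensor_mult:
  assumes "a \<in> carrier A" "b \<in> carrier B" "c \<in> carrier A" "d \<in> carrier B"
  shows "pure_tensor K A B a b \<otimes>\<^bsub>tensor K A B\<^esub> pure_tensor K A B c d =
    pure_tensor K A B (a \<otimes>\<^bsub>A\<^esub> c) (b \<otimes>\<^bsub>B\<^esub> d)"
  using assms
  by (simp add: tensor_mult_eq T.tensor_lift_pure[OF tensor_mult_inner_bilinear]
      T.tensor_lift_pure[OF pure_mult_bilinear])

lemma mult_tensor_bilinear:
  "(\<lambda>s t. s \<otimes>\<^bsub>tensor K A B\<^esub> t) \<in> bilinear_maps K (tensor K A B) (tensor K A B) (tensor K A B)"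
  by (rule bilinear_maps_cong[OF tensor_mult_bilinear tensor_module tensor_module tensor_mult_eq])

end

text \<open>
  Three maps are needed instead of one homomorphism because the group grading mixes the summands of
  \<open>H \<otimes> k[C\<^sub>2]\<close>: the embeddings of \<open>H\<close> satisfy, for example, \<open>(x \<otimes> g)(y \<otimes> g) = xy \<otimes> 1\<close>.
\<close>

lemma tensor_map_mult:
  assumes A: "assoc_algebra K A" and B: "assoc_algebra K B"
    and f: "f \<in> linear_maps K A B" and g: "g \<in> linear_maps K A B" and h: "h \<in> linear_maps K A B"
    and fgh: "\<And>x y. x \<in> carrier A \<Longrightarrow> y \<in> carrier A \<Longrightarrow> f x \<otimes>\<^bsub>B\<^esub> g y = h (x \<otimes>\<^bsub>A\<^esub> y)"
    and s: "s \<in> carrier (tensor K A A)" and t: "t \<in> carrier (tensor K A A)"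
  shows "tensor_map K B B f f s \<otimes>\<^bsub>tensor K B B\<^esub> tensor_map K B B g g t =
    tensor_map K B B h h (s \<otimes>\<^bsub>tensor K A A\<^esub> t)"
proof -
  interpret AA: algebra_pair K A A by (simp add: algebra_pair_def A)
  interpret BB: algebra_pair K B B by (simp add: algebra_pair_def B)
  note mods = AA.A.module_axioms AA.A.module_axioms BB.A.module_axioms BB.A.module_axioms
  interpret X: tensor_to_module K A A "tensor K B B"
    by (simp add: tensor_to_module_def AA.module_pair_axioms BB.tensor_module)
  note F = tensor_map_linear[OF mods f f] and G = tensor_map_linear[OF mods g g]
    and H = tensor_map_linear[OF mods h h]
  have pure: "tensor_map K B B f f (pure_tensor K A A a b) \<otimes>\<^bsub>tensor K B B\<^esub> tensor_map K B B g g u =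
      tensor_map K B B h h (pure_tensor K A A a b \<otimes>\<^bsub>tensor K A A\<^esub> u)"
    if "a \<in> carrier A" "b \<in> carrier A" "u \<in> carrier (tensor K A A)" for a b u
  proof (rule X.linear_maps_tensor_eqI[where t = u, OF _ _ _ that(3)])
    have "tensor_map K B B f f (pure_tensor K A A a b) \<in> carrier (tensor K B B)"
      by (intro linear_maps_closed[OF F]) (simp add: that)
    from linear_maps_comp[OF G bilinear_maps_right[OF BB.mult_tensor_bilinear this]]
    show "(\<lambda>u. tensor_map K B B f f (pure_tensor K A A a b) \<otimes>\<^bsub>tensor K B B\<^esub> tensor_map K B B g g u)
        \<in> linear_maps K (tensor K A A) (tensor K B B)" .
    have "pure_tensor K A A a b \<in> carrier (tensor K A A)" by (simp add: that)
    from linear_maps_comp[OF bilinear_maps_right[OF AA.mult_tensor_bilinear this] H]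
    show "(\<lambda>u. tensor_map K B B h h (pure_tensor K A A a b \<otimes>\<^bsub>tensor K A A\<^esub> u))
        \<in> linear_maps K (tensor K A A) (tensor K B B)" .
    show "tensor_map K B B f f (pure_tensor K A A a b) \<otimes>\<^bsub>tensor K B B\<^esub>
          tensor_map K B B g g (pure_tensor K A A c d) =
        tensor_map K B B h h (pure_tensor K A A a b \<otimes>\<^bsub>tensor K A A\<^esub> pure_tensor K A A c d)"
      if "c \<in> carrier A" "d \<in> carrier A" for c d
      using that \<open>a \<in> carrier A\<close> \<open>b \<in> carrier A\<close>
      by (simp add: tensor_map_pure[OF mods f f] tensor_map_pure[OF mods g g] tensor_map_pure[OF mods h h]
          AA.pure_tensor_mult BB.pure_tensor_mult linear_maps_closed[OF f] linear_maps_closed[OF g] fgh)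
  qed
  show ?thesis
  proof (rule X.linear_maps_tensor_eqI[where t = s, OF _ _ _ s])
    show "tensor_map K B B f f (pure_tensor K A A a b) \<otimes>\<^bsub>tensor K B B\<^esub> tensor_map K B B g g t =
        tensor_map K B B h h (pure_tensor K A A a b \<otimes>\<^bsub>tensor K A A\<^esub> t)"
      if "a \<in> carrier A" "b \<in> carrier A" for a b
      by (rule pure[OF that t])
    from linear_maps_comp[OF F bilinear_maps_left[OF BB.mult_tensor_bilinear linear_maps_closed[OF G t]]]
    show "(\<lambda>s. tensor_map K B B f f s \<otimes>\<^bsub>tensor K B B\<^esub> tensor_map K B B g g t)
        \<in> linear_maps K (tensor K A A) (tensor K B B)" .
    from linear_maps_comp[OF bilinear_maps_left[OF AA.mult_tensor_bilinear t] H]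
    show "(\<lambda>s. tensor_map K B B h h (s \<otimes>\<^bsub>tensor K A A\<^esub> t))
        \<in> linear_maps K (tensor K A A) (tensor K B B)" .
  qed
qed

lemma tensor_one: "\<one>\<^bsub>tensor K A A\<^esub> = pure_tensor K A A \<one>\<^bsub>A\<^esub> \<one>\<^bsub>A\<^esub>"
  by (simp add: tensor_def pure_tensor_def)


section \<open>Maps compatible with coproducts\<close>

lemma base_algebra_simps [simp]:
  "carrier (base_algebra K) = carrier K"
  "x \<otimes>\<^bsub>base_algebra K\<^esub> y = x \<otimes>\<^bsub>K\<^esub> y" "\<one>\<^bsub>base_algebra K\<^esub> = \<one>\<^bsub>K\<^esub>"
  "x \<oplus>\<^bsub>base_algebra K\<^esub> y = x \<oplus>\<^bsub>K\<^esub> y" "\<zero>\<^bsub>base_algebra K\<^esub> = \<zero>\<^bsub>K\<^esub>"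
  "c \<odot>\<^bsub>base_algebra K\<^esub> x = c \<otimes>\<^bsub>K\<^esub> x"
  by (simp_all add: base_algebra_def)

lemma tensor_lift_base_algebra: "tensor_lift (base_algebra K) \<beta> = tensor_lift K \<beta>"
  by (rule ext) (simp add: tensor_lift_def)

lemma module_base_algebra:
  assumes "cring K"
  shows "module K (base_algebra K)"
proof -
  interpret cring K by fact
  show ?thesis
    by (rule moduleI, rule assms, rule abelian_groupI) (auto simp: l_distr r_distr m_assoc a_ac l_neg intro: bexI[of _ "\<ominus>\<^bsub>K\<^esub> x" for x])
qed

lemma smult_bilinear:
  assumes "module K M"
  shows "(\<lambda>c x. c \<odot>\<^bsub>M\<^esub> x) \<in> bilinear_maps K (base_algebra K) M M"
proof -
  interpret module K M by fact
  show ?thesis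
    by (intro bilinear_mapsI linear_mapsI)
      (simp_all add: smult_l_distr smult_r_distr smult_assoc1[symmetric] m_comm)
qed

lemma smult_by_linear_form_bilinear:
  assumes "module K M" "\<epsilon> \<in> linear_maps K M (base_algebra K)"
  shows "(\<lambda>a b. \<epsilon> a \<odot>\<^bsub>M\<^esub> b) \<in> bilinear_maps K M M M"
    and "(\<lambda>a b. \<epsilon> b \<odot>\<^bsub>M\<^esub> a) \<in> bilinear_maps K M M M"
proof -
  show *: "(\<lambda>a b. \<epsilon> a \<odot>\<^bsub>M\<^esub> b) \<in> bilinear_maps K M M M"
    by (rule bilinear_maps_comp_linear[OF assms(2) linear_maps_ident smult_bilinear[OF assms(1)]])
  show "(\<lambda>a b. \<epsilon> b \<odot>\<^bsub>M\<^esub> a) \<in> bilinear_maps K M M M"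
    by (rule bilinear_mapsI[OF bilinear_maps_left[OF *] bilinear_maps_right[OF *]])
qed

lemma linear_maps_zero_map: "module K N \<Longrightarrow> (\<lambda>_. \<zero>\<^bsub>N\<^esub>) \<in> linear_maps K M N"
proof -
  assume "module K N"
  then interpret module K N .
  show ?thesis by (intro linear_mapsI) auto
qed

lemma tensor_map_ident:
  assumes "module K M" and t: "t \<in> carrier (tensor K M M)"
  shows "tensor_map K M M (\<lambda>a. a) (\<lambda>a. a) t = t"
proof -
  interpret M: tensor_to_module K M M "tensor K M M"
    by (simp add: tensor_to_module_def module_pair_def assms module_tensor)
  note mods = assms(1) assms(1) assms(1) assms(1)
  show ?thesis
    by (rule M.linear_maps_tensor_eqI[where f = "tensor_map K M M (\<lambda>a. a) (\<lambda>a. a)" and g = "\<lambda>t. t",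
        OF tensor_map_linear[OF mods linear_maps_ident linear_maps_ident] linear_maps_ident _ t])
      (simp add: tensor_map_pure[OF mods linear_maps_ident linear_maps_ident])
qed

lemma tensor_map_comp:
  assumes M: "module K M" and N: "module K N" and P: "module K P"
    and f: "f \<in> linear_maps K M N" and g: "g \<in> linear_maps K N P"
    and t: "t \<in> carrier (tensor K M M)"
    and h: "\<And>a. a \<in> carrier M \<Longrightarrow> g (f a) = h a"
  shows "tensor_map K P P g g (tensor_map K N N f f t) = tensor_map K P P h h t"
proof -
  interpret T: tensor_to_module K M M "tensor K P P"
    by (simp add: tensor_to_module_def module_pair_def M P module_tensor)
  have "tensor_map K P P g g (tensor_map K N N f f t) =
      tensor_lift (tensor K P P) (\<lambda>a b. pure_tensor K P P (g (f a)) (g (f b))) t"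
    unfolding tensor_map_def[of K P P]
    by (rule tensor_lift_tensor_map[OF M M N N f f module_tensor[OF P P]
          bilinear_maps_comp_linear[OF g g pure_tensor_bilinear[OF P P]] t])
  also have "\<dots> = tensor_map K P P h h t"
    unfolding tensor_map_def by (rule T.tensor_lift_cong[OF _ t]) (simp add: h)
  finally show ?thesis .
qed

locale comult_module = module K C for K (structure) and C :: "('k, 'c, 'y) hopf_scheme" (structure) +
  assumes comult_linear: "comult C \<in> linear_maps K C (tensor K C C)"
begin

sublocale CC: module_pair K C C by (simp add: module_pair_def module_axioms)

lemma tensor3_module: "module K (tensor K C (tensor K C C))"
  by (intro module_tensor module_axioms)

lemma comult_closed: "h \<in> carrier C \<Longrightarrow> comult C h \<in> carrier (tensor K C C)"
  by (rule linear_maps_closed[OF comult_linear])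

lemma pure3_bilinear:
  assumes "b \<in> carrier C"
  shows "(\<lambda>c d. pure_tensor K C (tensor K C C) c (pure_tensor K C C d b))
    \<in> bilinear_maps K C C (tensor K C (tensor K C C))"
  by (rule bilinear_maps_comp_linear[OF linear_maps_ident
      bilinear_maps_left[OF pure_tensor_bilinear[OF module_axioms module_axioms] assms]
      pure_tensor_bilinear[OF module_axioms CC.tensor_module]])

lemma comult_left_bilinear:
  "(\<lambda>a b. tensor_lift (tensor K C (tensor K C C))
      (\<lambda>c d. pure_tensor K C (tensor K C C) c (pure_tensor K C C d b)) (comult C a))
    \<in> bilinear_maps K C C (tensor K C (tensor K C C))"
proof (rule bilinear_mapsI)
  interpret T: tensor_to_module K C C "tensor K C (tensor K C C)"
    by (simp add: tensor_to_module_def CC.module_pair_axioms tensor3_module)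
  show "(\<lambda>a. tensor_lift (tensor K C (tensor K C C))
      (\<lambda>c d. pure_tensor K C (tensor K C C) c (pure_tensor K C C d b)) (comult C a))
      \<in> linear_maps K C (tensor K C (tensor K C C))" if "b \<in> carrier C" for b
    by (rule linear_maps_comp[OF comult_linear T.tensor_lift_linear[OF pure3_bilinear[OF that]]])
  show "(\<lambda>b. tensor_lift (tensor K C (tensor K C C))
      (\<lambda>c d. pure_tensor K C (tensor K C C) c (pure_tensor K C C d b)) (comult C a))
      \<in> linear_maps K C (tensor K C (tensor K C C))" if "a \<in> carrier C" for a
  proof (rule T.tensor_lift_linear_param[OF comult_closed[OF that] module_axioms pure3_bilinear])
    show "(\<lambda>b. pure_tensor K C (tensor K C C) c (pure_tensor K C C d b))
        \<in> linear_maps K C (tensor K C (tensor K C C))" if "c \<in> carrier C" "d \<in> carrier C" for c d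
      by (rule linear_maps_comp[OF
          bilinear_maps_right[OF pure_tensor_bilinear[OF module_axioms module_axioms] that(2)]
          bilinear_maps_right[OF pure_tensor_bilinear[OF module_axioms CC.tensor_module] that(1)]])
  qed
qed

lemma comult_right_bilinear:
  "(\<lambda>a b. pure_tensor K C (tensor K C C) a (comult C b)) \<in> bilinear_maps K C C (tensor K C (tensor K C C))"
  by (rule bilinear_maps_comp_linear[OF linear_maps_ident comult_linear
      pure_tensor_bilinear[OF module_axioms CC.tensor_module]])

lemma lift_comult_linear:
  assumes "module K P" "\<beta> \<in> bilinear_maps K C C P"
  shows "(\<lambda>h. tensor_lift P \<beta> (comult C h)) \<in> linear_maps K C P"
proof -
  interpret T: tensor_to_module K C C P
    by (simp add: tensor_to_module_def CC.module_pair_axioms assms)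
  show ?thesis by (rule linear_maps_comp[OF comult_linear T.tensor_lift_linear[OF assms(2)]])
qed

end

text \<open>
  The coassociativity, counit and antipode laws for an element in the image of a map \<open>f\<close> follow
  from the same laws in the source, provided that \<open>f\<close> commutes with the coproducts and with the
  operation concerned. A structure spanned by images of such maps therefore inherits them.
\<close>

locale comult_map = C: comult_module K C + D: comult_module K D
  for K (structure) and C and D +
  fixes f
  assumes linear: "f \<in> linear_maps K C D"
    and comult_map: "h \<in> carrier C \<Longrightarrow> comult D (f h) = tensor_map K D D f f (comult C h)"
begin

text \<open>
  This is the rule that moves a Sweedler computation from the target of \<open>f\<close> to its source: since
  \<open>f(h)\<^sub>1 \<otimes> f(h)\<^sub>2 = f(h\<^sub>1) \<otimes> f(h\<^sub>2)\<close>, the map \<open>\<beta>\<close> needs to be known only on the image of \<open>f\<close>, and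
  the linear map \<open>g\<close> can be taken out of the sum.
\<close>

lemma lift_comult_map:
  assumes P: "module K P" and Q: "module K Q"
    and \<beta>: "\<beta> \<in> bilinear_maps K D D Q" and \<gamma>: "\<gamma> \<in> bilinear_maps K C C P" and g: "g \<in> linear_maps K P Q"
    and \<beta>\<gamma>: "\<And>a b. a \<in> carrier C \<Longrightarrow> b \<in> carrier C \<Longrightarrow> \<beta> (f a) (f b) = g (\<gamma> a b)"
    and h: "h \<in> carrier C"
  shows "tensor_lift Q \<beta> (comult D (f h)) = g (tensor_lift P \<gamma> (comult C h))"
proof -
  interpret Q: tensor_to_module K C C Q
    by (simp add: tensor_to_module_def C.CC.module_pair_axioms Q)
  note t = C.comult_closed[OF h]
  have "tensor_lift Q \<beta> (comult D (f h)) = tensor_lift Q (\<lambda>a b. \<beta> (f a) (f b)) (comult C h)"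
    unfolding comult_map[OF h]
    by (rule tensor_lift_tensor_map[OF C.module_axioms C.module_axioms D.module_axioms D.module_axioms
          linear linear Q \<beta> t])
  also have "\<dots> = tensor_lift Q (\<lambda>a b. g (\<gamma> a b)) (comult C h)"
    by (rule Q.tensor_lift_cong[OF \<beta>\<gamma> t])
  also have "\<dots> = g (tensor_lift P \<gamma> (comult C h))"
    by (rule linear_comp_tensor_lift[OF C.module_axioms C.module_axioms P Q \<gamma> g t, symmetric])
  finally show ?thesis .
qed

text \<open>
  With \<open>F = f \<otimes> (f \<otimes> f)\<close>, both triple coproducts of \<open>f(h)\<close> are the images under \<open>F\<close> of the
  corresponding triple coproducts of \<open>h\<close>.
\<close>

lemma coassoc_image:
  assumes coassoc: "tensor_lift (tensor K C (tensor K C C))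
        (\<lambda>a b. tensor_lift (tensor K C (tensor K C C))
          (\<lambda>c d. pure_tensor K C (tensor K C C) c (pure_tensor K C C d b)) (comult C a))
        (comult C h) =
      tensor_lift (tensor K C (tensor K C C))
        (\<lambda>a b. pure_tensor K C (tensor K C C) a (comult C b)) (comult C h)"
    and h: "h \<in> carrier C"
  shows "tensor_lift (tensor K D (tensor K D D))
        (\<lambda>a b. tensor_lift (tensor K D (tensor K D D))
          (\<lambda>c d. pure_tensor K D (tensor K D D) c (pure_tensor K D D d b)) (comult D a))
        (comult D (f h)) =
      tensor_lift (tensor K D (tensor K D D))
        (\<lambda>a b. pure_tensor K D (tensor K D D) a (comult D b)) (comult D (f h))"
proof -
  note mods = C.module_axioms C.module_axioms D.module_axioms D.module_axioms
  note mods3 = C.module_axioms C.CC.tensor_module D.module_axioms D.CC.tensor_module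
  note F2 = tensor_map_linear[OF mods linear linear]
  define F where "F = tensor_map K D (tensor K D D) f (tensor_map K D D f f)"
  have F: "F \<in> linear_maps K (tensor K C (tensor K C C)) (tensor K D (tensor K D D))"
    unfolding F_def by (rule tensor_map_linear[OF mods3 linear F2])
  have F_pure: "F (pure_tensor K C (tensor K C C) a t) =
      pure_tensor K D (tensor K D D) (f a) (tensor_map K D D f f t)"
    if "a \<in> carrier C" "t \<in> carrier (tensor K C C)" for a t
    unfolding F_def by (rule tensor_map_pure[OF mods3 linear F2 that])
  have inner: "tensor_lift (tensor K D (tensor K D D))
        (\<lambda>c d. pure_tensor K D (tensor K D D) c (pure_tensor K D D d (f b))) (comult D (f a)) =
      F (tensor_lift (tensor K C (tensor K C C))
        (\<lambda>c d. pure_tensor K C (tensor K C C) c (pure_tensor K C C d b)) (comult C a))"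
    if "a \<in> carrier C" "b \<in> carrier C" for a b
    by (rule lift_comult_map[OF C.tensor3_module D.tensor3_module
          D.pure3_bilinear[OF linear_maps_closed[OF linear that(2)]] C.pure3_bilinear[OF that(2)] F _ that(1)])
      (simp add: that F_pure tensor_map_pure[OF mods linear linear])
  note lift_comult_map[OF C.tensor3_module D.tensor3_module D.comult_left_bilinear
      C.comult_left_bilinear F inner h]
  also note coassoc
  also note lift_comult_map[OF C.tensor3_module D.tensor3_module D.comult_right_bilinear
      C.comult_right_bilinear F _ h, symmetric]
  finally show ?thesis
    by (simp add: F_pure C.comult_closed comult_map)
qed

end


section \<open>Extension of a Hopf algebra by a group of order two\<close>

text \<open>
  A coproduct takes values in the tensor square of the underlying algebra. That algebra is therefore
  defined first, as a record without coproduct, and this lemma serves to show that the fields added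
  later leave its tensor square unchanged.
\<close>

lemma tensor_rel_mono:
  assumes "(xs, ys) \<in> tensor_rel K M N"
    and "carrier M = carrier M'" "ring.add M = ring.add M'" "\<zero>\<^bsub>M\<^esub> = \<zero>\<^bsub>M'\<^esub>" "module.smult M = module.smult M'"
    and "carrier N = carrier N'" "ring.add N = ring.add N'" "module.smult N = module.smult N'"
  shows "(xs, ys) \<in> tensor_rel K M' N'"
  using assms by (induction rule: tensor_rel.induct) (auto intro: tensor_rel.intros simp del: in_lists_conv_set)

text \<open>
  The group algebra extension \<open>H \<otimes> k[C\<^sub>2]\<close>, where \<open>C\<^sub>2 = {1, g}\<close>: the pair \<open>(a, b)\<close> stands for
  \<open>a \<otimes> 1 + b \<otimes> g\<close>. The tensor product is written out in coordinates so that its elements are pairs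
  of elements of \<open>H\<close>.
\<close>

definition C2_algebra :: "('k, 'h, 'y) module_scheme \<Rightarrow> ('k, 'h \<times> 'h) module" where
  "C2_algebra H = \<lparr>carrier = carrier H \<times> carrier H,
     monoid.mult = (\<lambda>(a, b) (c, d).
       ((a \<otimes>\<^bsub>H\<^esub> c) \<oplus>\<^bsub>H\<^esub> (b \<otimes>\<^bsub>H\<^esub> d), (a \<otimes>\<^bsub>H\<^esub> d) \<oplus>\<^bsub>H\<^esub> (b \<otimes>\<^bsub>H\<^esub> c))),
     one = (\<one>\<^bsub>H\<^esub>, \<zero>\<^bsub>H\<^esub>),
     ring.zero = (\<zero>\<^bsub>H\<^esub>, \<zero>\<^bsub>H\<^esub>),
     ring.add = (\<lambda>(a, b) (c, d). (a \<oplus>\<^bsub>H\<^esub> c, b \<oplus>\<^bsub>H\<^esub> d)),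
     module.smult = (\<lambda>c (a, b). (c \<odot>\<^bsub>H\<^esub> a, c \<odot>\<^bsub>H\<^esub> b))\<rparr>"

text \<open>
  The generator \<open>g\<close> is grouplike, so \<open>\<Delta>(b \<otimes> g) = (b\<^sub>1 \<otimes> g) \<otimes> (b\<^sub>2 \<otimes> g)\<close> and \<open>\<epsilon>(g) = 1\<close>; the antipode
  fixes it because \<open>g\<close> is its own inverse.
\<close>

definition C2_hopf :: "('k, 'x) ring_scheme \<Rightarrow> ('k, 'h, 'y) hopf_scheme \<Rightarrow> ('k, 'h \<times> 'h) hopf" where
  "C2_hopf K H = module.extend (C2_algebra H) (hopf.fields
     (\<lambda>(a, b). tensor_map K (C2_algebra H) (C2_algebra H) (\<lambda>x. (x, \<zero>\<^bsub>H\<^esub>)) (\<lambda>x. (x, \<zero>\<^bsub>H\<^esub>)) (comult H a)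
       \<oplus>\<^bsub>tensor K (C2_algebra H) (C2_algebra H)\<^esub>
       tensor_map K (C2_algebra H) (C2_algebra H) (\<lambda>x. (\<zero>\<^bsub>H\<^esub>, x)) (\<lambda>x. (\<zero>\<^bsub>H\<^esub>, x)) (comult H b))
     (\<lambda>(a, b). counit H a \<oplus>\<^bsub>K\<^esub> counit H b)
     (\<lambda>(a, b). (antipode H a, antipode H b)))"

lemma C2_hopf_module_fields:
  "carrier (C2_hopf K H) = carrier (C2_algebra H)"
  "monoid.mult (C2_hopf K H) = monoid.mult (C2_algebra H)" "\<one>\<^bsub>C2_hopf K H\<^esub> = \<one>\<^bsub>C2_algebra H\<^esub>"
  "ring.add (C2_hopf K H) = ring.add (C2_algebra H)" "\<zero>\<^bsub>C2_hopf K H\<^esub> = \<zero>\<^bsub>C2_algebra H\<^esub>"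
  "module.smult (C2_hopf K H) = module.smult (C2_algebra H)"
  by (simp_all add: C2_hopf_def module.defs)

lemma C2_hopf_simps [simp]:
  "carrier (C2_hopf K H) = carrier H \<times> carrier H"
  "(a, b) \<otimes>\<^bsub>C2_hopf K H\<^esub> (c, d) =
    ((a \<otimes>\<^bsub>H\<^esub> c) \<oplus>\<^bsub>H\<^esub> (b \<otimes>\<^bsub>H\<^esub> d), (a \<otimes>\<^bsub>H\<^esub> d) \<oplus>\<^bsub>H\<^esub> (b \<otimes>\<^bsub>H\<^esub> c))"
  "\<one>\<^bsub>C2_hopf K H\<^esub> = (\<one>\<^bsub>H\<^esub>, \<zero>\<^bsub>H\<^esub>)"
  "\<zero>\<^bsub>C2_hopf K H\<^esub> = (\<zero>\<^bsub>H\<^esub>, \<zero>\<^bsub>H\<^esub>)"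
  "(a, b) \<oplus>\<^bsub>C2_hopf K H\<^esub> (c, d) = (a \<oplus>\<^bsub>H\<^esub> c, b \<oplus>\<^bsub>H\<^esub> d)"
  "k \<odot>\<^bsub>C2_hopf K H\<^esub> (a, b) = (k \<odot>\<^bsub>H\<^esub> a, k \<odot>\<^bsub>H\<^esub> b)"
  "counit (C2_hopf K H) (a, b) = counit H a \<oplus>\<^bsub>K\<^esub> counit H b"
  "antipode (C2_hopf K H) (a, b) = (antipode H a, antipode H b)"
  by (simp_all add: C2_hopf_def C2_algebra_def module.defs hopf.defs)

lemma tensor_C2_algebra:
  "tensor K (C2_algebra H) (C2_algebra H) = tensor K (C2_hopf K H) (C2_hopf K H)"
  "tensor_class K (C2_algebra H) (C2_algebra H) = tensor_class K (C2_hopf K H) (C2_hopf K H)"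
proof -
  have rel: "tensor_rel K (C2_hopf K H) (C2_hopf K H) = tensor_rel K (C2_algebra H) (C2_algebra H)"
    by (intro subset_antisym subrelI; erule tensor_rel_mono; rule C2_hopf_module_fields[symmetric] C2_hopf_module_fields)
  then have cls: "tensor_class K (C2_hopf K H) (C2_hopf K H) = tensor_class K (C2_algebra H) (C2_algebra H)"
    by (intro ext) (simp only: tensor_class_def)
  then show "tensor_class K (C2_algebra H) (C2_algebra H) = tensor_class K (C2_hopf K H) (C2_hopf K H)"
    by simp
  show "tensor K (C2_algebra H) (C2_algebra H) = tensor K (C2_hopf K H) (C2_hopf K H)"
    by (simp only: tensor_def rel cls C2_hopf_module_fields)
qed

lemma tensor_map_C2_algebra:
  "tensor_map K (C2_algebra H) (C2_algebra H) f g = tensor_map K (C2_hopf K H) (C2_hopf K H) f g"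
  by (simp add: tensor_map_def pure_tensor_def tensor_C2_algebra)

lemma comult_C2_hopf:
  "comult (C2_hopf K H) (a, b) =
    tensor_map K (C2_hopf K H) (C2_hopf K H) (\<lambda>x. (x, \<zero>\<^bsub>H\<^esub>)) (\<lambda>x. (x, \<zero>\<^bsub>H\<^esub>)) (comult H a)
    \<oplus>\<^bsub>tensor K (C2_hopf K H) (C2_hopf K H)\<^esub>
    tensor_map K (C2_hopf K H) (C2_hopf K H) (\<lambda>x. (\<zero>\<^bsub>H\<^esub>, x)) (\<lambda>x. (\<zero>\<^bsub>H\<^esub>, x)) (comult H b)"
proof -
  have "comult (C2_hopf K H) (a, b) =
      tensor_map K (C2_algebra H) (C2_algebra H) (\<lambda>x. (x, \<zero>\<^bsub>H\<^esub>)) (\<lambda>x. (x, \<zero>\<^bsub>H\<^esub>)) (comult H a)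
      \<oplus>\<^bsub>tensor K (C2_algebra H) (C2_algebra H)\<^esub>
      tensor_map K (C2_algebra H) (C2_algebra H) (\<lambda>x. (\<zero>\<^bsub>H\<^esub>, x)) (\<lambda>x. (\<zero>\<^bsub>H\<^esub>, x)) (comult H b)"
    by (simp add: C2_hopf_def module.defs hopf.defs)
  then show ?thesis by (simp only: tensor_C2_algebra tensor_map_C2_algebra)
qed

context hopf_algebra
begin

abbreviation L where "L \<equiv> C2_hopf K H"

text \<open>
  The embeddings \<open>a \<mapsto> a \<otimes> 1\<close> and \<open>b \<mapsto> b \<otimes> g\<close>.
\<close>

abbreviation in_one where "in_one \<equiv> \<lambda>x. (x, \<zero>\<^bsub>H\<^esub>)"
abbreviation in_gen where "in_gen \<equiv> \<lambda>x. (\<zero>\<^bsub>H\<^esub>, x)"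

lemma H_comult_module: "comult_module K H"
  using comult_hom by unfold_locales (simp add: algebra_homs_def)

sublocale HC: comult_module K H by (rule H_comult_module)

lemma counit_linear: "counit H \<in> linear_maps K H (base_algebra K)"
  and counit_mult: "a \<in> carrier H \<Longrightarrow> b \<in> carrier H \<Longrightarrow> counit H (a \<otimes>\<^bsub>H\<^esub> b) = counit H a \<otimes> counit H b"
  and counit_one: "counit H \<one>\<^bsub>H\<^esub> = \<one>"
  using counit_hom by (auto simp: algebra_homs_def ring_hom_def)

lemma base_module: "module K (base_algebra K)"
  by (rule module_base_algebra) unfold_locales

lemma counit_closed [simp]: "a \<in> carrier H \<Longrightarrow> counit H a \<in> carrier K"
  using linear_maps_closed[OF counit_linear] by simp

lemma counit_zero [simp]: "counit H \<zero>\<^bsub>H\<^esub> = \<zero>"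
  using linear_maps_zero[OF module_axioms base_module counit_linear] by simp

lemma antipode_closed [simp]: "a \<in> carrier H \<Longrightarrow> antipode H a \<in> carrier H"
  by (rule linear_maps_closed[OF antipode_linear])

lemma antipode_zero [simp]: "antipode H \<zero>\<^bsub>H\<^esub> = \<zero>\<^bsub>H\<^esub>"
  by (rule linear_maps_zero[OF module_axioms module_axioms antipode_linear])

lemma C2_assoc_algebra: "assoc_algebra K L"
proof -
  have ag: "abelian_group L"
  proof (rule abelian_groupI)
    show "\<exists>y \<in> carrier L. y \<oplus>\<^bsub>L\<^esub> x = \<zero>\<^bsub>L\<^esub>" if "x \<in> carrier L" for x
      using that by (intro bexI[of _ "(\<ominus>\<^bsub>H\<^esub> fst x, \<ominus>\<^bsub>H\<^esub> snd x)"]) (auto simp: M.l_neg)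
  qed (auto simp: M.a_ac)
  have mon: "monoid L"
    by (rule monoidI) (auto simp: A.m_assoc A.l_distr A.r_distr M.a_ac)
  have mod: "module K L"
    by (rule moduleI) (auto simp: ag smult_l_distr smult_r_distr smult_assoc1, unfold_locales)
  have ring: "ring L"
    by (rule ringI[OF ag mon]) (auto simp: A.l_distr A.r_distr M.a_ac)
  show ?thesis
    by (intro assoc_algebra.intro mod ring assoc_algebra_axioms.intro)
      (auto simp: smult_mult_left smult_mult_right smult_r_distr, unfold_locales)
qed

sublocale L: assoc_algebra K L by (rule C2_assoc_algebra)

lemma in_one_linear: "in_one \<in> linear_maps K H L"
  and in_gen_linear: "in_gen \<in> linear_maps K H L"
  by (auto intro!: linear_mapsI)

text \<open>
  All Hopf algebra axioms are linear in the element concerned, so they need to be checked only on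
  \<open>a \<otimes> 1\<close> and \<open>b \<otimes> g\<close>.
\<close>

lemma C2_linear_eqI:
  assumes "f \<in> linear_maps K L P" "g \<in> linear_maps K L P"
    and "\<And>a. a \<in> carrier H \<Longrightarrow> f (in_one a) = g (in_one a)"
    and "\<And>b. b \<in> carrier H \<Longrightarrow> f (in_gen b) = g (in_gen b)"
    and "h \<in> carrier L"
  shows "f h = g h"
proof -
  obtain a b where h: "h = in_one a \<oplus>\<^bsub>L\<^esub> in_gen b" "a \<in> carrier H" "b \<in> carrier H"
    using assms(5) by (cases h) auto
  have "in_one a \<in> carrier L" "in_gen b \<in> carrier L" using h by auto
  then show ?thesis
    by (simp only: h linear_maps_add[OF assms(1)] linear_maps_add[OF assms(2)] assms(3,4))
qed

sublocale LL: algebra_pair K L L by (simp add: algebra_pair_def C2_assoc_algebra)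

lemmas H_L_modules = module_axioms module_axioms L.module_axioms L.module_axioms

lemmas in_one_tensor_linear = tensor_map_linear[OF H_L_modules in_one_linear in_one_linear]
lemmas in_gen_tensor_linear = tensor_map_linear[OF H_L_modules in_gen_linear in_gen_linear]

lemmas in_one_comult_linear = linear_maps_comp[OF HC.comult_linear in_one_tensor_linear]
lemmas in_gen_comult_linear = linear_maps_comp[OF HC.comult_linear in_gen_tensor_linear]

lemma C2_comult_linear: "comult L \<in> linear_maps K L (tensor K L L)"
  by (rule linear_mapsI)
    (auto simp: comult_C2_hopf linear_maps_closed[OF in_one_comult_linear] linear_maps_closed[OF in_gen_comult_linear]
      linear_maps_add[OF in_one_comult_linear] linear_maps_add[OF in_gen_comult_linear]
      linear_maps_smult[OF in_one_comult_linear] linear_maps_smult[OF in_gen_comult_linear]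
      LL.T.P.smult_r_distr LL.T.P.M.a_ac)

lemma comult_in_one: "a \<in> carrier H \<Longrightarrow> comult L (in_one a) = tensor_map K L L in_one in_one (comult H a)"
  using linear_maps_zero[OF module_axioms LL.tensor_module in_gen_comult_linear]
  by (simp add: comult_C2_hopf linear_maps_closed[OF in_one_comult_linear])

lemma comult_in_gen: "b \<in> carrier H \<Longrightarrow> comult L (in_gen b) = tensor_map K L L in_gen in_gen (comult H b)"
  using linear_maps_zero[OF module_axioms LL.tensor_module in_one_comult_linear]
  by (simp add: comult_C2_hopf linear_maps_closed[OF in_gen_comult_linear])

sublocale LC: comult_module K L
  by (intro comult_module.intro comult_module_axioms.intro L.module_axioms C2_comult_linear)

sublocale one: comult_map K H L in_one
  by (intro comult_map.intro comult_map_axioms.intro H_comult_module LC.comult_module_axioms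
      in_one_linear comult_in_one)

sublocale gen: comult_map K H L in_gen
  by (intro comult_map.intro comult_map_axioms.intro H_comult_module LC.comult_module_axioms
      in_gen_linear comult_in_gen)

lemma C2_comult_mult:
  assumes "h \<in> carrier L" "k \<in> carrier L"
  shows "comult L (h \<otimes>\<^bsub>L\<^esub> k) = comult L h \<otimes>\<^bsub>tensor K L L\<^esub> comult L k"
proof -
  note left = linear_maps_comp[OF bilinear_maps_left[OF mult_bilinear[OF C2_assoc_algebra]] C2_comult_linear]
    linear_maps_comp[OF C2_comult_linear bilinear_maps_left[OF LL.mult_tensor_bilinear LC.comult_closed]]
  note right = linear_maps_comp[OF bilinear_maps_right[OF mult_bilinear[OF C2_assoc_algebra]] C2_comult_linear]
    linear_maps_comp[OF C2_comult_linear bilinear_maps_right[OF LL.mult_tensor_bilinear LC.comult_closed]]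
  have comult_mult: "comult H (a \<otimes>\<^bsub>H\<^esub> b) = comult H a \<otimes>\<^bsub>tensor K H H\<^esub> comult H b"
    if "a \<in> carrier H" "b \<in> carrier H" for a b
    using comult_hom that by (auto simp: algebra_homs_def ring_hom_def)
  \<comment> \<open>The four products of \<open>x \<otimes> 1\<close> and \<open>x \<otimes> g\<close> with \<open>y \<otimes> 1\<close> and \<open>y \<otimes> g\<close> are handled uniformly.\<close>
  have gens: "comult L (f a \<otimes>\<^bsub>L\<^esub> g b) = comult L (f a) \<otimes>\<^bsub>tensor K L L\<^esub> comult L (g b)"
    if f: "comult_map K H L f" and g: "comult_map K H L g" and e: "comult_map K H L e"
      and fge: "\<And>a b. a \<in> carrier H \<Longrightarrow> b \<in> carrier H \<Longrightarrow> f a \<otimes>\<^bsub>L\<^esub> g b = e (a \<otimes>\<^bsub>H\<^esub> b)"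
      and ab: "a \<in> carrier H" "b \<in> carrier H" for f g e a b
  proof -
    have "a \<otimes>\<^bsub>H\<^esub> b \<in> carrier H" using ab by simp
    then show ?thesis
      unfolding fge[OF ab] comult_map.comult_map[OF f ab(1)] comult_map.comult_map[OF g ab(2)]
        comult_map.comult_map[OF e \<open>a \<otimes>\<^bsub>H\<^esub> b \<in> carrier H\<close>] comult_mult[OF ab]
      by (intro tensor_map_mult[OF assoc_algebra_axioms C2_assoc_algebra
          f[THEN comult_map.linear] g[THEN comult_map.linear] e[THEN comult_map.linear] fge, symmetric]
          HC.comult_closed ab)
  qed
  note one_gen = one.comult_map_axioms gen.comult_map_axioms
  have one_left: "comult L (in_one a \<otimes>\<^bsub>L\<^esub> k) = comult L (in_one a) \<otimes>\<^bsub>tensor K L L\<^esub> comult L k"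
    if a: "a \<in> carrier H" for a
  proof (rule C2_linear_eqI[where h = k, OF right _ _ assms(2)])
    show "comult L (in_one a \<otimes>\<^bsub>L\<^esub> in_one b) = comult L (in_one a) \<otimes>\<^bsub>tensor K L L\<^esub> comult L (in_one b)"
      if "b \<in> carrier H" for b
      by (rule gens[OF one_gen(1,1,1) _ a that]) simp
    show "comult L (in_one a \<otimes>\<^bsub>L\<^esub> in_gen b) = comult L (in_one a) \<otimes>\<^bsub>tensor K L L\<^esub> comult L (in_gen b)"
      if "b \<in> carrier H" for b
      by (rule gens[OF one_gen(1,2,2) _ a that]) simp
  qed (use a in auto)
  have gen_left: "comult L (in_gen a \<otimes>\<^bsub>L\<^esub> k) = comult L (in_gen a) \<otimes>\<^bsub>tensor K L L\<^esub> comult L k"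
    if a: "a \<in> carrier H" for a
  proof (rule C2_linear_eqI[where h = k, OF right _ _ assms(2)])
    show "comult L (in_gen a \<otimes>\<^bsub>L\<^esub> in_one b) = comult L (in_gen a) \<otimes>\<^bsub>tensor K L L\<^esub> comult L (in_one b)"
      if "b \<in> carrier H" for b
      by (rule gens[OF one_gen(2,1,2) _ a that]) simp
    show "comult L (in_gen a \<otimes>\<^bsub>L\<^esub> in_gen b) = comult L (in_gen a) \<otimes>\<^bsub>tensor K L L\<^esub> comult L (in_gen b)"
      if "b \<in> carrier H" for b
      by (rule gens[OF one_gen(2,2,1) _ a that]) simp
  qed (use a in auto)
  show ?thesis
    by (rule C2_linear_eqI[where h = h, OF left[OF assms(2)] one_left gen_left assms(1)])
qed

lemma counit_add: "a \<in> carrier H \<Longrightarrow> b \<in> carrier H \<Longrightarrow> counit H (a \<oplus>\<^bsub>H\<^esub> b) = counit H a \<oplus> counit H b"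
  and counit_smult: "c \<in> carrier K \<Longrightarrow> a \<in> carrier H \<Longrightarrow> counit H (c \<odot>\<^bsub>H\<^esub> a) = c \<otimes> counit H a"
  using linear_maps_add[OF counit_linear] linear_maps_smult[OF counit_linear] by simp_all

lemma C2_counit_linear: "counit L \<in> linear_maps K L (base_algebra K)"
  by (rule linear_mapsI) (auto simp: counit_add counit_smult K.r_distr K.a_ac)

lemma C2_antipode_linear: "antipode L \<in> linear_maps K L L"
  by (rule linear_mapsI)
    (auto simp: linear_maps_add[OF antipode_linear] linear_maps_smult[OF antipode_linear])

lemma C2_hopf_algebra: "hopf_algebra K L"
proof -
  note bil_H = smult_by_linear_form_bilinear[OF module_axioms counit_linear]
  note bil_L = smult_by_linear_form_bilinear[OF L.module_axioms C2_counit_linear]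
  note S_H = bilinear_maps_comp_linear[OF antipode_linear linear_maps_ident mult_bilinear[OF assoc_algebra_axioms]]
    bilinear_maps_comp_linear[OF linear_maps_ident antipode_linear mult_bilinear[OF assoc_algebra_axioms]]
  note S_L = bilinear_maps_comp_linear[OF C2_antipode_linear linear_maps_ident mult_bilinear[OF C2_assoc_algebra]]
    bilinear_maps_comp_linear[OF linear_maps_ident C2_antipode_linear mult_bilinear[OF C2_assoc_algebra]]
  have unit: "(\<lambda>h. counit L h \<odot>\<^bsub>L\<^esub> \<one>\<^bsub>L\<^esub>) \<in> linear_maps K L L"
    by (rule linear_maps_comp[OF C2_counit_linear bilinear_maps_left[OF smult_bilinear[OF L.module_axioms]]])
      simp
  show ?thesis
  proof (intro hopf_algebra.intro hopf_algebra_axioms.intro C2_assoc_algebra C2_antipode_linear)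
    have "comult H \<one>\<^bsub>H\<^esub> = pure_tensor K H H \<one>\<^bsub>H\<^esub> \<one>\<^bsub>H\<^esub>"
      using comult_hom by (auto simp: algebra_homs_def ring_hom_def tensor_one)
    then have "comult L \<one>\<^bsub>L\<^esub> = \<one>\<^bsub>tensor K L L\<^esub>"
      by (simp add: comult_in_one tensor_map_pure[OF H_L_modules in_one_linear in_one_linear] tensor_one)
    then show "comult L \<in> algebra_homs K L (tensor K L L)"
      unfolding algebra_homs_def
      by (intro IntI C2_comult_linear ring_hom_memI LC.comult_closed C2_comult_mult
          linear_maps_add[OF C2_comult_linear])
    show "counit L \<in> algebra_homs K L (base_algebra K)"
      using C2_counit_linear
      by (auto simp: algebra_homs_def counit_mult counit_one counit_add
          K.l_distr K.r_distr K.a_ac intro!: ring_hom_memI)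
    show "tensor_lift (tensor K L (tensor K L L))
        (\<lambda>a b. tensor_lift (tensor K L (tensor K L L))
          (\<lambda>c d. pure_tensor K L (tensor K L L) c (pure_tensor K L L d b)) (comult L a))
        (comult L h) =
      tensor_lift (tensor K L (tensor K L L))
        (\<lambda>a b. pure_tensor K L (tensor K L L) a (comult L b)) (comult L h)" if "h \<in> carrier L" for h
      by (rule C2_linear_eqI[where h = h,
            OF LC.lift_comult_linear[OF LC.tensor3_module LC.comult_left_bilinear]
              LC.lift_comult_linear[OF LC.tensor3_module LC.comult_right_bilinear]
              one.coassoc_image[OF coassoc] gen.coassoc_image[OF coassoc] that])
    show "tensor_lift L (\<lambda>a b. counit L a \<odot>\<^bsub>L\<^esub> b) (comult L h) = h" if "h \<in> carrier L" for h
    proof (rule C2_linear_eqI[where h = h, OF LC.lift_comult_linear[OF L.module_axioms bil_L(1)] linear_maps_ident _ _ that])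
      fix a assume a: "a \<in> carrier H"
      show "tensor_lift L (\<lambda>a b. counit L a \<odot>\<^bsub>L\<^esub> b) (comult L (in_one a)) = in_one a"
        using one.lift_comult_map[OF module_axioms L.module_axioms bil_L(1) bil_H(1) in_one_linear _ a]
        by (simp add: counit_left a)
      show "tensor_lift L (\<lambda>a b. counit L a \<odot>\<^bsub>L\<^esub> b) (comult L (in_gen a)) = in_gen a"
        using gen.lift_comult_map[OF module_axioms L.module_axioms bil_L(1) bil_H(1) in_gen_linear _ a]
        by (simp add: counit_left a)
    qed
    show "tensor_lift L (\<lambda>a b. counit L b \<odot>\<^bsub>L\<^esub> a) (comult L h) = h" if "h \<in> carrier L" for h
    proof (rule C2_linear_eqI[where h = h, OF LC.lift_comult_linear[OF L.module_axioms bil_L(2)] linear_maps_ident _ _ that])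
      fix a assume a: "a \<in> carrier H"
      show "tensor_lift L (\<lambda>a b. counit L b \<odot>\<^bsub>L\<^esub> a) (comult L (in_one a)) = in_one a"
        using one.lift_comult_map[OF module_axioms L.module_axioms bil_L(2) bil_H(2) in_one_linear _ a]
        by (simp add: counit_right a)
      show "tensor_lift L (\<lambda>a b. counit L b \<odot>\<^bsub>L\<^esub> a) (comult L (in_gen a)) = in_gen a"
        using gen.lift_comult_map[OF module_axioms L.module_axioms bil_L(2) bil_H(2) in_gen_linear _ a]
        by (simp add: counit_right a)
    qed
    show "tensor_lift L (\<lambda>a b. antipode L a \<otimes>\<^bsub>L\<^esub> b) (comult L h) = counit L h \<odot>\<^bsub>L\<^esub> \<one>\<^bsub>L\<^esub>"
      if "h \<in> carrier L" for h
    proof (rule C2_linear_eqI[where h = h, OF LC.lift_comult_linear[OF L.module_axioms S_L(1)] unit _ _ that])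
      fix a assume a: "a \<in> carrier H"
      show "tensor_lift L (\<lambda>a b. antipode L a \<otimes>\<^bsub>L\<^esub> b) (comult L (in_one a)) = counit L (in_one a) \<odot>\<^bsub>L\<^esub> \<one>\<^bsub>L\<^esub>"
        using one.lift_comult_map[OF module_axioms L.module_axioms S_L(1) S_H(1) in_one_linear _ a]
        by (simp add: antipode_left a)
      show "tensor_lift L (\<lambda>a b. antipode L a \<otimes>\<^bsub>L\<^esub> b) (comult L (in_gen a)) = counit L (in_gen a) \<odot>\<^bsub>L\<^esub> \<one>\<^bsub>L\<^esub>"
        using gen.lift_comult_map[OF module_axioms L.module_axioms S_L(1) S_H(1) in_one_linear _ a]
        by (simp add: antipode_left a)
    qed
    show "tensor_lift L (\<lambda>a b. a \<otimes>\<^bsub>L\<^esub> antipode L b) (comult L h) = counit L h \<odot>\<^bsub>L\<^esub> \<one>\<^bsub>L\<^esub>"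
      if "h \<in> carrier L" for h
    proof (rule C2_linear_eqI[where h = h, OF LC.lift_comult_linear[OF L.module_axioms S_L(2)] unit _ _ that])
      fix a assume a: "a \<in> carrier H"
      show "tensor_lift L (\<lambda>a b. a \<otimes>\<^bsub>L\<^esub> antipode L b) (comult L (in_one a)) = counit L (in_one a) \<odot>\<^bsub>L\<^esub> \<one>\<^bsub>L\<^esub>"
        using one.lift_comult_map[OF module_axioms L.module_axioms S_L(2) S_H(2) in_one_linear _ a]
        by (simp add: antipode_right a)
      show "tensor_lift L (\<lambda>a b. a \<otimes>\<^bsub>L\<^esub> antipode L b) (comult L (in_gen a)) = counit L (in_gen a) \<odot>\<^bsub>L\<^esub> \<one>\<^bsub>L\<^esub>"
        using gen.lift_comult_map[OF module_axioms L.module_axioms S_L(2) S_H(2) in_one_linear _ a]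
        by (simp add: antipode_right a)
    qed
  qed
qed


section \<open>The partial action supported on the identity component\<close>

text \<open>
  The partial action is \<open>\<epsilon> \<otimes> \<delta>\<close>, where \<open>\<delta>(1) = 1\<close> and \<open>\<delta>(g) = 0\<close> is the partial action of \<open>k[C\<^sub>2]\<close>
  that belongs to the trivial subgroup.
\<close>

abbreviation action where "action \<equiv> \<lambda>h :: 'h \<times> 'h. counit H (fst h)"

lemma fst_linear: "fst \<in> linear_maps K L H"
  by (rule linear_mapsI) auto

lemma action_linear: "action \<in> linear_maps K L (base_algebra K)"
  by (rule linear_maps_comp[OF fst_linear counit_linear])

text \<open>
  On \<open>a \<otimes> 1\<close> both sides reduce, by the counit law, to \<open>\<epsilon>(a)\<close> times the value at \<open>k\<close>. On \<open>b \<otimes> g\<close> both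
  sides vanish, since both tensor factors of \<open>\<Delta>(b \<otimes> g)\<close> lie in \<open>H \<otimes> g\<close>, where the action is zero.
\<close>

lemma action_partial: "partial_action K L action"
  unfolding partial_action_def
proof (intro conjI ballI action_linear)
  show "action \<one>\<^bsub>L\<^esub> = \<one>" by (simp add: counit_one)
next
  fix h k assume h: "h \<in> carrier L" and k: "k \<in> carrier L"
  obtain c d where k_eq: "k = (c, d)" and cd: "c \<in> carrier H" "d \<in> carrier H" using k by auto
  define \<beta> where "\<beta> = (\<lambda>a b. action a \<otimes> action (b \<otimes>\<^bsub>L\<^esub> k))"
  have \<beta>: "\<beta> \<in> bilinear_maps K L L (base_algebra K)"
    using bilinear_maps_comp_linear[OF action_linear
        linear_maps_comp[OF bilinear_maps_left[OF mult_bilinear[OF C2_assoc_algebra] k] action_linear]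
        smult_bilinear[OF base_module]]
    by (simp add: \<beta>_def)
  note \<epsilon> = smult_by_linear_form_bilinear(1)[OF module_axioms counit_linear]
  have "action k \<in> carrier (base_algebra K)" using linear_maps_closed[OF action_linear k] .
  note lhs = linear_maps_comp[OF action_linear bilinear_maps_left[OF smult_bilinear[OF base_module] this], simplified]
  have in_one_mult: "(\<lambda>x. action (in_one x \<otimes>\<^bsub>L\<^esub> k)) \<in> linear_maps K H (base_algebra K)"
    by (rule linear_maps_comp[OF linear_maps_comp[OF in_one_linear
        bilinear_maps_left[OF mult_bilinear[OF C2_assoc_algebra] k]] action_linear])
  have "action h \<otimes> action k = tensor_lift (base_algebra K) \<beta> (comult L h)"
  proof (rule C2_linear_eqI[where h = h, OF lhs LC.lift_comult_linear[OF base_module \<beta>] _ _ h])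
    fix a assume a: "a \<in> carrier H"
    have "tensor_lift (base_algebra K) \<beta> (comult L (in_one a)) =
        action (in_one (tensor_lift H (\<lambda>a b. counit H a \<odot>\<^bsub>H\<^esub> b) (comult H a)) \<otimes>\<^bsub>L\<^esub> k)"
      by (rule one.lift_comult_map[OF module_axioms base_module \<beta> \<epsilon> in_one_mult _ a])
        (simp add: \<beta>_def k_eq cd counit_mult counit_smult K.m_assoc)
    also have "\<dots> = action (in_one a) \<otimes> action k"
      by (simp add: counit_left a k_eq cd counit_mult)
    finally show "action (in_one a) \<otimes> action k = tensor_lift (base_algebra K) \<beta> (comult L (in_one a))" ..
    have "tensor_lift (base_algebra K) \<beta> (comult L (in_gen a)) = \<zero>\<^bsub>base_algebra K\<^esub>"
      by (rule gen.lift_comult_map[OF module_axioms base_module \<beta> \<epsilon> linear_maps_zero_map[OF base_module] _ a])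
        (simp add: \<beta>_def k_eq cd)
    then show "action (in_gen a) \<otimes> action k = tensor_lift (base_algebra K) \<beta> (comult L (in_gen a))"
      by (simp add: k_eq cd)
  qed
  then show "action h \<otimes> action k = tensor_lift K (\<lambda>a b. action a \<otimes> action (b \<otimes>\<^bsub>L\<^esub> k)) (comult L h)"
    by (simp add: \<beta>_def tensor_lift_base_algebra)
qed

lemma action_neq_counit: "\<exists>h \<in> carrier L. action h \<noteq> counit L h"
  by (intro bexI[of _ "(\<zero>\<^bsub>H\<^esub>, \<one>\<^bsub>H\<^esub>)"]) (simp_all add: counit_one)

text \<open>
  The map \<open>h \<mapsto> \<lambda>(h\<^sub>1) h\<^sub>2\<close> kills \<open>H \<otimes> g\<close> and, by the counit law, fixes \<open>H \<otimes> 1\<close>.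
\<close>

lemma smash_projection:
  assumes "h \<in> carrier L"
  shows "tensor_lift L (\<lambda>a b. action a \<odot>\<^bsub>L\<^esub> b) (comult L h) = in_one (fst h)"
proof -
  note \<lambda> = smult_by_linear_form_bilinear(1)[OF L.module_axioms action_linear]
  note \<epsilon> = smult_by_linear_form_bilinear(1)[OF module_axioms counit_linear]
  show ?thesis
  proof (rule C2_linear_eqI[where h = h, OF LC.lift_comult_linear[OF L.module_axioms \<lambda>]
        linear_maps_comp[OF fst_linear in_one_linear] _ _ assms])
    fix a assume a: "a \<in> carrier H"
    show "tensor_lift L (\<lambda>a b. action a \<odot>\<^bsub>L\<^esub> b) (comult L (in_one a)) = in_one (fst (in_one a))"
      using one.lift_comult_map[OF module_axioms L.module_axioms \<lambda> \<epsilon> in_one_linear _ a]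
      by (simp add: counit_left a)
    show "tensor_lift L (\<lambda>a b. action a \<odot>\<^bsub>L\<^esub> b) (comult L (in_gen a)) = in_one (fst (in_gen a))"
      using gen.lift_comult_map[OF module_axioms L.module_axioms \<lambda> \<epsilon> linear_maps_zero_map[OF L.module_axioms] _ a]
      by simp
  qed
qed

lemma partial_smash_eq: "partial_smash L action = in_one ` carrier H"
proof -
  have "partial_smash L action = (\<lambda>h. in_one (fst h)) ` carrier L"
    unfolding partial_smash_def by (rule image_cong) (simp_all only: smash_projection)
  also have "\<dots> = in_one ` carrier H" by force
  finally show ?thesis .
qed

text \<open>
  The copy \<open>H \<otimes> 1\<close> of \<open>H\<close>, with the operations of \<open>H \<otimes> k[C\<^sub>2]\<close>.
\<close>

abbreviation H1 where "H1 \<equiv> L\<lparr>carrier := in_one ` carrier H\<rparr>"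

lemma H1_submodule: "submodule (in_one ` carrier H) K L"
proof (rule L.module_incl_imp_submodule)
  show "in_one ` carrier H \<subseteq> carrier L" by auto
  show "module K H1"
  proof (rule moduleI)
    show "abelian_group H1"
    proof (rule abelian_groupI)
      show "\<exists>y \<in> carrier H1. y \<oplus>\<^bsub>H1\<^esub> x = \<zero>\<^bsub>H1\<^esub>" if "x \<in> carrier H1" for x
        using that by (intro bexI[of _ "in_one (\<ominus>\<^bsub>H\<^esub> fst x)"]) (auto simp: M.l_neg)
    qed (auto simp: M.a_ac)
  qed (auto simp: smult_l_distr smult_r_distr smult_assoc1, unfold_locales)
qed

lemma H1_module: "module K H1"
  by (rule submodule.submodule_is_module[OF H1_submodule L.module_axioms])

lemma H1_subring: "subring (in_one ` carrier H) L"
proof (rule L.subringI)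
  show "\<ominus>\<^bsub>L\<^esub> h \<in> in_one ` carrier H" if "h \<in> in_one ` carrier H" for h
    using L.submoduleE(3)[OF H1_submodule that] .
qed auto

lemma in_one_H1_linear: "in_one \<in> linear_maps K H H1"
  by (rule linear_mapsI) auto

lemma H1_incl_linear: "(\<lambda>x. x) \<in> linear_maps K H1 L"
  by (rule linear_mapsI) auto

lemma H1_retract_linear: "(\<lambda>x. in_one (fst x)) \<in> linear_maps K L H1"
  by (rule linear_mapsI) auto

lemma H1_fst_linear: "fst \<in> linear_maps K H1 H"
  by (rule linear_mapsI) auto

lemma tensor_incl_in_one:
  assumes "a \<in> carrier H"
  shows "tensor_incl K L (tensor_map K H1 H1 in_one in_one (comult H a)) = comult L (in_one a)"
  unfolding tensor_incl_def comult_in_one[OF assms]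
  by (rule tensor_map_comp[OF module_axioms H1_module L.module_axioms in_one_H1_linear H1_incl_linear
        HC.comult_closed[OF assms]]) simp

text \<open>
  The linear projection onto \<open>H \<otimes> 1\<close> is a retraction of the inclusion, and tensoring it with itself
  gives a left inverse of the map between the tensor squares.
\<close>

lemma tensor_incl_inj: "inj_on (tensor_incl K L) (carrier (tensor K H1 H1))"
proof (rule inj_on_inverseI)
  fix t assume t: "t \<in> carrier (tensor K H1 H1)"
  have "tensor_map K H1 H1 (\<lambda>x. in_one (fst x)) (\<lambda>x. in_one (fst x)) (tensor_incl K L t) =
      tensor_map K H1 H1 (\<lambda>x. x) (\<lambda>x. x) t"
    unfolding tensor_incl_def
    by (rule tensor_map_comp[OF H1_module L.module_axioms H1_module H1_incl_linear H1_retract_linear t]) auto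
  then show "tensor_map K H1 H1 (\<lambda>x. in_one (fst x)) (\<lambda>x. in_one (fst x)) (tensor_incl K L t) = t"
    by (simp only: tensor_map_ident[OF H1_module t])
qed

lemma in_one_comult_closed:
  "a \<in> carrier H \<Longrightarrow> tensor_map K H1 H1 in_one in_one (comult H a) \<in> carrier (tensor K H1 H1)"
  by (rule linear_maps_closed[OF tensor_map_linear[OF module_axioms module_axioms H1_module H1_module
        in_one_H1_linear in_one_H1_linear] HC.comult_closed])

lemma H1_hopf_subalgebra: "hopf_subalgebra K (in_one ` carrier H) L"
  unfolding hopf_subalgebra_def
proof (intro conjI H1_submodule H1_subring ballI)
  fix h assume "h \<in> in_one ` carrier H"
  then obtain a where a: "a \<in> carrier H" "h = in_one a" by blast
  then show "antipode L h \<in> in_one ` carrier H" by simp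
  show "comult L h \<in> tensor_incl K L ` carrier (tensor K H1 H1)"
    unfolding a(2) tensor_incl_in_one[OF a(1), symmetric]
    by (rule imageI[OF in_one_comult_closed[OF a(1)]])
qed

text \<open>
  The inherited coproduct is defined by choosing a preimage under \<^const>\<open>tensor_incl\<close>. Injectivity
  identifies that preimage as the coproduct of \<open>H\<close>, carried over to \<open>H \<otimes> 1\<close>.
\<close>

lemma sub_hopf_comult:
  assumes "a \<in> carrier H"
  shows "comult (sub_hopf K L (in_one ` carrier H)) (in_one a) = tensor_map K H1 H1 in_one in_one (comult H a)"
  unfolding sub_hopf_def
  by (simp add: inv_into_f_eq[OF tensor_incl_inj in_one_comult_closed tensor_incl_in_one] assms)

lemma H1_isomorphic: "hopf_isomorphic K (sub_hopf K L (in_one ` carrier H)) H"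
  unfolding hopf_isomorphic_def
proof (rule bexI[of _ fst])
  let ?S = "sub_hopf K L (in_one ` carrier H)"
  show "bij_betw fst (carrier ?S) (carrier H)"
    by (rule bij_betw_byWitness[of _ in_one]) (auto simp: sub_hopf_def)
  have "fst \<in> linear_maps K ?S H"
    by (rule linear_mapsI) (auto simp: sub_hopf_def)
  moreover have "fst \<in> ring_hom ?S H"
    by (rule ring_hom_memI) (auto simp: sub_hopf_def)
  moreover have "comult H (fst h) = tensor_map K H H fst fst (comult ?S h)"
    if "h \<in> carrier ?S" for h
  proof -
    have "h \<in> in_one ` carrier H" using that by (simp add: sub_hopf_def)
    then obtain a where a: "a \<in> carrier H" "h = in_one a" by blast
    have "tensor_map K H H fst fst (comult ?S h) = tensor_map K H H (\<lambda>x. x) (\<lambda>x. x) (comult H a)"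
      unfolding a(2) sub_hopf_comult[OF a(1)]
      by (rule tensor_map_comp[OF module_axioms H1_module module_axioms in_one_H1_linear H1_fst_linear
            HC.comult_closed[OF a(1)]]) simp
    then show ?thesis
      by (simp add: a tensor_map_ident[OF module_axioms HC.comult_closed])
  qed
  moreover have "counit H (fst h) = counit ?S h \<and> antipode H (fst h) = fst (antipode ?S h)"
    if "h \<in> carrier ?S" for h
    using that by (auto simp: sub_hopf_def)
  ultimately show "fst \<in> hopf_homs K ?S H"
    unfolding hopf_homs_def algebra_homs_def by simp
qed

end

section \<open>Every Hopf algebra is the algebra of a non-global partial action\<close>

theorem theorem4p13:
  fixes K :: "'k ring" and H :: "('k, 'h) hopf"
  assumes "hopf_algebra K H"
  shows "\<exists>(L :: ('k, 'h \<times> 'h) hopf) (l :: 'h \<times> 'h \<Rightarrow> 'k).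
    hopf_algebra K L \<and> partial_action K L l \<and>
    (\<exists>h \<in> carrier L. l h \<noteq> counit L h) \<and>
    hopf_subalgebra K (partial_smash L l) L \<and>
    hopf_isomorphic K (sub_hopf K L (partial_smash L l)) H"
proof -
  interpret hopf_algebra K H by fact
  have "hopf_subalgebra K (partial_smash L action) L"
    "hopf_isomorphic K (sub_hopf K L (partial_smash L action)) H"
    unfolding partial_smash_eq by (rule H1_hopf_subalgebra H1_isomorphic)+
  with C2_hopf_algebra action_partial action_neq_counit show ?thesis by blast
qed

end
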